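(* Let $(X,d)$ be a compact metric space and let $v$ be a gradient-like flow on $X$ with finitely many fixed points $p_1,\dots,p_n$ and Lyapunov function $g$. Let $\alpha$ be a continuous 1-cocycle on $X$ with an associated $r$-covering, where $r>0$ is small enough that the images $g(B_r(p_j))$, $j=1,\dots,n$, are mutually disjoint. Let $0<s_0<\frac r4$ satisfy $$3\,\max_{x\in X}\ \operatorname{osc}_{y\in B_{s_0}(x)}g(y)<\delta_0(r),\qquad \delta_0(r):=\min_{1\le j\le n}\delta^{\pm}_{r,\frac r4}(p_j).$$ Then there exist $M>0$ and $T(s_0)>0$, depending on $r,n,\alpha$ but not on $s$, such that for every $s<s_0$, every covering $\mathcal U(s)$ of $X$ by balls of radius $s$, and every $(\mathcal U(s),T(s_0))$-chain $\tilde\gamma$, $$\Big|\int_{\tilde\gamma}\alpha\Big|\le M .$$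
   Context: A flow $v$ is a continuous $\mathbb R$-action $(x,t)\mapsto x\cdot t$ on $X$; $[x,x\cdot t]$ denotes the trajectory segment from $x$ to $x\cdot t$. The flow is gradient-like if there is a continuous function $g:X\to\mathbb R$ (a Lyapunov function) which is strictly decreasing along every nonconstant trajectory. Cocycles. A continuous 1-cocycle (in bounded Alexander–Spanier cohomology) is a bounded function $\alpha:X\times X\to\mathbb R$ for which there is $r>0$ such that for each open ball $B$ of radius $r$ there is a bounded continuous function $\beta_B$ on $\bar B$ with $\alpha(x,y)=\beta_B(y)-\beta_B(x)$ for $x,y\in\bar B$. The covering $\mathcal U(r)$ by these balls is called an $r$-covering associated with $\alpha$. For a curve $\gamma:[a,b]\to X$, $\int_\gamma\alpha=\sum_i\alpha(\gamma(\tau_i),\gamma(\tau_{i+1}))$ for any subdivision $a=\tau_0<\dots<\tau_N=b$ fine enough that each piece $\gamma([\tau_i,\tau_{i+1}])$ lies in a ball of the covering. Chains. Let $\mathcal U(s)$ be a covering of $X$ by balls of radius $s$. A $(\mathcal U(s),T)$-chain from $x$ to $x'$ is a sequence $\{x=x_1,\dots,x_{k+1}=x'\mid t_1,\dots,t_k\}$ with $t_i\ge T$ and such that each pair $(x_i\cdot t_i,x_{i+1})$ lies in a common ball of $\mathcal U(s)$. For such a chain $\tilde\gamma$, $\int_{\tilde\gamma}\alpha=\sum_i\big(\int_{[x_i,x_i\cdot t_i]}\alpha+\alpha(x_i\cdot t_i,x_{i+1})\big)$. The numbers $\delta^\pm$. For a fixed point $p$ and $0<s<\frac r2$ put $$B^{+}_{r,s}(p)=\{x\in\partial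 B_r(p): [x,x\cdot t]\cap\partial B_s(p)\ne\emptyset\text{ for some }t>0\},$$ and define $B^-_{r,s}(p)$ in the same way with $t<0$. For $x\in B^+_{r,s}(p)$ let $t_x>0$ be the first time at which $x\cdot t$ $(t>0)$ reaches $\partial B_{r/2}(p)$, and let $\delta_x=\frac12\big(g(x)-g(x\cdot t_x)\big)>0$; set $\delta^+_{r,s}(p)=\inf_{x\in B^+_{r,s}(p)}\delta_x$ (a positive number). Define $\delta^-_{r,s}(p)$ analogously using backward time: for $x\in B^-_{r,s}(p)$, $t_x>0$ is the first time with $x\cdot(-t_x)\in\partial B_{r/2}(p)$ and $\delta_x=\frac12(g(x\cdot(-t_x))-g(x))$. The minimum in $\delta_0(r)$ is over all $j$ and both signs. $\operatorname{osc}_{Y}g=\sup_Yg-\inf_Yg$. *)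

theory Defs
  imports "HOL-Analysis.Analysis"
begin

text \<open>
  The compact metric space is the whole type \<open>'a::metric_space\<close>; \<open>v x t\<close> stands for \<open>x \<cdot> t\<close>.
  Boundaries of balls are topological boundaries (\<open>frontier\<close>), which may be smaller than metric
  spheres.
\<close>

definition is_flow :: "('a::metric_space \<Rightarrow> real \<Rightarrow> 'a) \<Rightarrow> bool" where
  "is_flow v \<longleftrightarrow>
     continuous_on UNIV (\<lambda>(x, t). v x t) \<and>
     (\<forall>x. v x 0 = x) \<and>
     (\<forall>x s t. v (v x s) t = v x (s + t))"

definition fixed_points :: "('a \<Rightarrow> real \<Rightarrow> 'a) \<Rightarrow> 'a set" where
  "fixed_points v = {p. \<forall>t. v p t = p}"

definition segment :: "('a \<Rightarrow> real \<Rightarrow> 'a) \<Rightarrow> 'a \<Rightarrow> real \<Rightarrow> 'a set" where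
  "segment v x t = v x ` closed_segment 0 t"

definition lyapunov_function :: "('a::metric_space \<Rightarrow> real \<Rightarrow> 'a) \<Rightarrow> ('a \<Rightarrow> real) \<Rightarrow> bool" where
  "lyapunov_function v g \<longleftrightarrow>
     continuous_on UNIV g \<and>
     (\<forall>x. x \<notin> fixed_points v \<longrightarrow> (\<forall>s t. s < t \<longrightarrow> g (v x t) < g (v x s)))"

definition gradient_like :: "('a::metric_space \<Rightarrow> real \<Rightarrow> 'a) \<Rightarrow> bool" where
  "gradient_like v \<longleftrightarrow> is_flow v \<and> (\<exists>g. lyapunov_function v g)"

definition associated_covering :: "('a::metric_space \<times> 'a \<Rightarrow> real) \<Rightarrow> real \<Rightarrow> bool" where
  "associated_covering \<alpha> r \<longleftrightarrow>
     r > 0 \<and>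
     (\<forall>c. \<exists>\<beta> :: 'a \<Rightarrow> real.
        continuous_on (closure (ball c r)) \<beta> \<and>
        bounded (\<beta> ` closure (ball c r)) \<and>
        (\<forall>x \<in> closure (ball c r). \<forall>y \<in> closure (ball c r). \<alpha> (x, y) = \<beta> y - \<beta> x))"

definition continuous_cocycle :: "('a::metric_space \<times> 'a \<Rightarrow> real) \<Rightarrow> bool" where
  "continuous_cocycle \<alpha> \<longleftrightarrow> bounded (range \<alpha>) \<and> (\<exists>r. associated_covering \<alpha> r)"

text \<open>A subdivision \<open>a = \<tau> 0 < \<dots> < \<tau> N = b\<close> each piece of which is mapped into some ball of radius \<open>r\<close>.\<close>

definition fine_subdivision ::
    "real \<Rightarrow> (real \<Rightarrow> 'a::metric_space) \<Rightarrow> real \<Rightarrow> real \<Rightarrow> nat \<Rightarrow> (nat \<Rightarrow> real) \<Rightarrow> bool" where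
  "fine_subdivision r \<gamma> a b N \<tau> \<longleftrightarrow>
     \<tau> 0 = a \<and> \<tau> N = b \<and>
     (\<forall>i<N. \<tau> i < \<tau> (Suc i) \<and> (\<exists>c. \<gamma> ` {\<tau> i..\<tau> (Suc i)} \<subseteq> ball c r))"

text \<open>
  The common value of the sums over all fine subdivisions. For a cocycle \<open>\<alpha>\<close> with associated
  covering of radius \<open>r\<close> and a continuous \<open>\<gamma>\<close> on \<open>{a..b}\<close>, fine subdivisions exist (Lebesgue number)
  and all give the same sum (common refinement).
\<close>

definition curve_integral ::
    "('a::metric_space \<times> 'a \<Rightarrow> real) \<Rightarrow> real \<Rightarrow> (real \<Rightarrow> 'a) \<Rightarrow> real \<Rightarrow> real \<Rightarrow> real" where
  "curve_integral \<alpha> r \<gamma> a b =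
     (THE I. \<forall>N \<tau>. fine_subdivision r \<gamma> a b N \<tau> \<longrightarrow> I = (\<Sum>i<N. \<alpha> (\<gamma> (\<tau> i), \<gamma> (\<tau> (Suc i)))))"

definition ball_covering :: "'a::metric_space set set \<Rightarrow> real \<Rightarrow> bool" where
  "ball_covering \<U> s \<longleftrightarrow> s > 0 \<and> (\<forall>U \<in> \<U>. \<exists>c. U = ball c s) \<and> \<Union>\<U> = UNIV"

text \<open>Indices are shifted by one: points \<open>x 0, \<dots>, x k\<close> and times \<open>t 0, \<dots>, t (k - 1)\<close>.\<close>

definition chain ::
    "('a \<Rightarrow> real \<Rightarrow> 'a) \<Rightarrow> 'a set set \<Rightarrow> real \<Rightarrow> nat \<Rightarrow> (nat \<Rightarrow> 'a) \<Rightarrow> (nat \<Rightarrow> real) \<Rightarrow> bool" where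
  "chain v \<U> T k x t \<longleftrightarrow>
     k \<ge> 1 \<and> (\<forall>i<k. t i \<ge> T \<and> (\<exists>U \<in> \<U>. v (x i) (t i) \<in> U \<and> x (Suc i) \<in> U))"

definition chain_integral ::
    "('a::metric_space \<Rightarrow> real \<Rightarrow> 'a) \<Rightarrow> ('a \<times> 'a \<Rightarrow> real) \<Rightarrow> real \<Rightarrow>
     nat \<Rightarrow> (nat \<Rightarrow> 'a) \<Rightarrow> (nat \<Rightarrow> real) \<Rightarrow> real" where
  "chain_integral v \<alpha> r k x t =
     (\<Sum>i<k. curve_integral \<alpha> r (v (x i)) 0 (t i) + \<alpha> (v (x i) (t i), x (Suc i)))"

definition B_plus :: "('a::metric_space \<Rightarrow> real \<Rightarrow> 'a) \<Rightarrow> real \<Rightarrow> real \<Rightarrow> 'a \<Rightarrow> 'a set" where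
  "B_plus v r s p =
     {x \<in> frontier (ball p r). \<exists>t>0. segment v x t \<inter> frontier (ball p s) \<noteq> {}}"

definition B_minus :: "('a::metric_space \<Rightarrow> real \<Rightarrow> 'a) \<Rightarrow> real \<Rightarrow> real \<Rightarrow> 'a \<Rightarrow> 'a set" where
  "B_minus v r s p =
     {x \<in> frontier (ball p r). \<exists>t<0. segment v x t \<inter> frontier (ball p s) \<noteq> {}}"

definition t_plus :: "('a::metric_space \<Rightarrow> real \<Rightarrow> 'a) \<Rightarrow> real \<Rightarrow> 'a \<Rightarrow> 'a \<Rightarrow> real" where
  "t_plus v r p x = (LEAST t. t > 0 \<and> v x t \<in> frontier (ball p (r / 2)))"

definition t_minus :: "('a::metric_space \<Rightarrow> real \<Rightarrow> 'a) \<Rightarrow> real \<Rightarrow> 'a \<Rightarrow> 'a \<Rightarrow> real" where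
  "t_minus v r p x = (LEAST t. t > 0 \<and> v x (- t) \<in> frontier (ball p (r / 2)))"

text \<open>The infima are extended reals, so that they are \<open>\<infinity>\<close> when no trajectory qualifies.\<close>

definition delta_plus ::
    "('a::metric_space \<Rightarrow> real \<Rightarrow> 'a) \<Rightarrow> ('a \<Rightarrow> real) \<Rightarrow> real \<Rightarrow> real \<Rightarrow> 'a \<Rightarrow> ereal" where
  "delta_plus v g r s p =
     (INF x \<in> B_plus v r s p. ereal ((g x - g (v x (t_plus v r p x))) / 2))"

definition delta_minus ::
    "('a::metric_space \<Rightarrow> real \<Rightarrow> 'a) \<Rightarrow> ('a \<Rightarrow> real) \<Rightarrow> real \<Rightarrow> real \<Rightarrow> 'a \<Rightarrow> ereal" where
  "delta_minus v g r s p =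
     (INF x \<in> B_minus v r s p. ereal ((g (v x (- t_minus v r p x)) - g x) / 2))"

definition delta0 ::
    "('a::metric_space \<Rightarrow> real \<Rightarrow> 'a) \<Rightarrow> ('a \<Rightarrow> real) \<Rightarrow> real \<Rightarrow> ereal" where
  "delta0 v g r =
     Min ((\<lambda>p. min (delta_plus v g r (r / 4) p) (delta_minus v g r (r / 4) p)) ` fixed_points v)"

definition osc :: "('a \<Rightarrow> real) \<Rightarrow> 'a set \<Rightarrow> real" where
  "osc g Y = (SUP y \<in> Y. g y) - (INF y \<in> Y. g y)"

end

theory Submission
  imports Defs
begin

text \<open>
  A long trajectory must come close to a fixed point, so one can choose on every segment of a chain
  a point \<open>u i\<close> in a small ball around some fixed point \<open>p i\<close> (lemma \<open>visits_fixed_points\<close>). The chain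
  thereby becomes a walk \<open>p 0, p 1, \<dots>\<close> on the finite set of fixed points, and the integral of \<open>\<alpha>\<close> up
  to \<open>u i\<close> is a potential \<open>\<Phi> i\<close> along this walk. It has to be shown that \<open>\<Phi>\<close> stays bounded however
  long the walk is.

  While the walk rests at one fixed point \<open>p\<close>, the chain stays in \<open>B\<^sub>r(p)\<close> (lemma \<open>link_stay\<close>): crossing
  the shell between radius \<open>r/4\<close> and radius \<open>r\<close> costs \<open>2 D\<close> of the Lyapunov function, where \<open>D\<close> is a
  lower bound of \<open>\<delta>\<^sub>0(r)\<close>, and a jump cannot earn this back. In \<open>B\<^sub>r(p)\<close> the cocycle is a coboundary, so
  the integral telescopes to \<open>\<alpha> (u i, u j)\<close>, which is at most \<open>sup \<bar>\<alpha>\<bar>\<close>. Each step of the walk changes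
  \<open>\<Phi>\<close> by a bounded amount, because the integral of \<open>\<alpha>\<close> along any trajectory is bounded by one constant
  (lemma \<open>trajectory_integral_bounded\<close>).

  It remains to bound the number of moves from one fixed point to another. Moves that decrease \<open>g\<close>
  pose no problem. Moves that increase \<open>g\<close> do occur, since a jump may lead up from the vicinity of \<open>b\<close>
  to the vicinity of \<open>p\<close> when \<open>g p\<close> is only slightly larger than \<open>g b\<close>. The disjointness of the images
  \<open>g (B\<^sub>r(q))\<close> prevents a cycle. A trajectory leaving \<open>B\<^sub>r(p)\<close> from near \<open>p\<close> takes in \<open>B\<^sub>r(p)\<close> all values
  down to \<open>2 D\<close> below its starting value, among them \<open>g b\<close>; hence trajectories from near \<open>p\<close> are trapped
  in \<open>B\<^sub>r(p)\<close>, and even in \<open>B\<^bsub>r/2\<^esub>(p)\<close> (lemma \<open>half_ball_exit_is_final\<close>). The walk then leaves \<open>p\<close> by a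
  jump that starts in \<open>B\<^bsub>r/2\<^esub>(p)\<close> and is shorter than \<open>r/2\<close>, so it lands in \<open>B\<^sub>r(p)\<close>, outside the ball of
  radius \<open>r\<close> around the next fixed point \<open>q\<close>. Entering that ball costs \<open>2 D\<close>, which brings \<open>g q\<close> below
  \<open>g b\<close> (lemma \<open>link_rebound\<close>). So every climb is followed by a descent below its origin, and the number
  of moves is at most twice the number of fixed points (lemma \<open>potential_bound_by_node_count\<close>).
\<close>


section \<open>Potentials along a sequence of nodes\<close>

lemma maximal_constant_run:
  fixes c :: "nat \<Rightarrow> 'b"
  assumes "i \<le> m"
  obtains j where "i \<le> j" "j \<le> m" "\<forall>l\<in>{i..j}. c l = c i" "j = m \<or> c (Suc j) \<noteq> c i"
proof -
  have "\<exists>j. i \<le> j \<and> j \<le> m \<and> (\<forall>l\<in>{i..j}. c l = c i) \<and> (j = m \<or> c (Suc j) \<noteq> c i)"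
    using assms
  proof (induction m rule: dec_induct)
    case base
    have "\<forall>l\<in>{i..i}. c l = c i" by simp
    then show ?case by blast
  next
    case (step n)
    then obtain j where j: "i \<le> j" "j \<le> n" "\<forall>l\<in>{i..j}. c l = c i" "j = n \<or> c (Suc j) \<noteq> c i"
      by blast
    show ?case
    proof (cases "c (Suc j) = c i")
      case True
      then have "\<forall>l\<in>{i..Suc j}. c l = c i" "Suc j = Suc n"
        using j by (metis atLeastAtMostSuc_conv insertE le_SucI, blast)
      then show ?thesis using j(1) by (metis le_SucI order_refl)
    next
      case False
      then show ?thesis using j by (metis le_SucI)
    qed
  qed
  with that show thesis by blast
qed

text \<open>
  Induction on the rank of the current node in the order given by \<open>h\<close>: after a constant run the walk
  either descends, or climbs, rests, and then by \<open>rebound\<close> descends below the node from which it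
  climbed. In both cases it has used at most two runs and two steps to reach a node of smaller rank.
\<close>

lemma potential_bound_by_node_count:
  fixes c :: "nat \<Rightarrow> 'b" and h :: "'b \<Rightarrow> real" and \<Phi> :: "nat \<Rightarrow> real"
  assumes fin: "finite P" and nodes: "\<And>i. i \<le> m \<Longrightarrow> c i \<in> P" and inj: "inj_on h P"
    and nonneg: "0 \<le> A" "0 \<le> K"
    and step: "\<And>i. i < m \<Longrightarrow> \<bar>\<Phi> (Suc i) - \<Phi> i\<bar> \<le> K"
    and run: "\<And>i j. i \<le> j \<Longrightarrow> j \<le> m \<Longrightarrow> \<forall>l\<in>{i..j}. c l = c i \<Longrightarrow> \<bar>\<Phi> j - \<Phi> i\<bar> \<le> A"
    and rebound: "\<And>i j. i < j \<Longrightarrow> j < m \<Longrightarrow> h (c i) < h (c (Suc i)) \<Longrightarrow>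
        \<forall>l\<in>{Suc i..j}. c l = c (Suc i) \<Longrightarrow> c (Suc j) \<noteq> c (Suc i) \<Longrightarrow> h (c (Suc j)) < h (c i)"
  shows "\<bar>\<Phi> m - \<Phi> 0\<bar> \<le> 2 * real (card P) * (A + K)"
proof -
  define rank where "rank x = card {q\<in>P. h q < h x}" for x
  have rank_less: "rank x < rank y" if "x \<in> P" "h x < h y" for x y
    unfolding rank_def using that fin by (intro psubset_card_mono) auto
  have bound: "\<bar>\<Phi> m - \<Phi> i\<bar> \<le> 2 * real (Suc (rank (c i))) * (A + K)" if "i \<le> m" for i
    using that
  proof (induction "rank (c i)" arbitrary: i rule: less_induct)
    case less
    have IH: "\<bar>\<Phi> m - \<Phi> l\<bar> \<le> 2 * real (rank (c i)) * (A + K)"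
      if "l \<le> m" "h (c l) < h (c i)" for l
    proof -
      have lt: "rank (c l) < rank (c i)"
        using that nodes by (intro rank_less) auto
      have "\<bar>\<Phi> m - \<Phi> l\<bar> \<le> 2 * real (Suc (rank (c l))) * (A + K)"
        using less.hyps[OF lt] that by simp
      also have "\<dots> \<le> 2 * real (rank (c i)) * (A + K)"
        using lt nonneg by (intro mult_right_mono) auto
      finally show ?thesis .
    qed
    define B where "B = 2 * real (rank (c i)) * (A + K)"
    have expand: "2 * real (Suc (rank (c i))) * (A + K) = B + 2 * A + 2 * K"
      by (simp add: B_def algebra_simps)
    have rank_part: "0 \<le> B"
      using nonneg by (simp add: B_def)
    obtain j where j: "i \<le> j" "j \<le> m" "\<forall>l\<in>{i..j}. c l = c i" "j = m \<or> c (Suc j) \<noteq> c i"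
      by (rule maximal_constant_run[OF less.prems])
    have run_j: "\<bar>\<Phi> j - \<Phi> i\<bar> \<le> A"
      using run j by blast
    show ?case
    proof (cases "j = m")
      case True
      show ?thesis using run_j rank_part nonneg unfolding True[symmetric] expand by linarith
    next
      case False
      then have jm: "j < m" and ne: "c (Suc j) \<noteq> c i"
        using j(2,4) by auto
      have cj: "c j = c i"
        using j(1,3) by (meson atLeastAtMost_iff order_refl)
      have step_j: "\<bar>\<Phi> (Suc j) - \<Phi> j\<bar> \<le> K"
        using step jm by blast
      have "h (c (Suc j)) \<noteq> h (c i)"
        using inj ne nodes[of "Suc j"] nodes[of i] jm less.prems by (auto dest: inj_onD)
      then consider "h (c (Suc j)) < h (c i)" | "h (c i) < h (c (Suc j))"
        by linarith
      then show ?thesis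
      proof cases
        case 1
        then have "\<bar>\<Phi> m - \<Phi> (Suc j)\<bar> \<le> B"
          using IH jm unfolding B_def by simp
        then show ?thesis using run_j step_j nonneg unfolding expand by linarith
      next
        case 2
        obtain l where l: "Suc j \<le> l" "l \<le> m" "\<forall>q\<in>{Suc j..l}. c q = c (Suc j)"
            "l = m \<or> c (Suc l) \<noteq> c (Suc j)"
          by (rule maximal_constant_run[OF Suc_leI[OF jm]])
        have run_l: "\<bar>\<Phi> l - \<Phi> (Suc j)\<bar> \<le> A"
          using run l by blast
        show ?thesis
        proof (cases "l = m")
          case True
          show ?thesis using run_j step_j run_l rank_part nonneg unfolding True[symmetric] expand by linarith
        next
          case False
          then have lm: "l < m" and ne': "c (Suc l) \<noteq> c (Suc j)"
            using l(2,4) by auto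
          have "h (c (Suc l)) < h (c j)"
            using rebound[OF _ lm _ l(3) ne'] l(1) 2 cj by simp
          then have "\<bar>\<Phi> m - \<Phi> (Suc l)\<bar> \<le> B"
            using IH lm cj unfolding B_def by simp
          moreover have "\<bar>\<Phi> (Suc l) - \<Phi> l\<bar> \<le> K"
            using step lm by blast
          ultimately show ?thesis using run_j step_j run_l nonneg unfolding expand by linarith
        qed
      qed
    qed
  qed
  have "rank (c 0) < card P"
    unfolding rank_def using fin nodes[of 0] by (intro psubset_card_mono) auto
  then have "2 * real (Suc (rank (c 0))) * (A + K) \<le> 2 * real (card P) * (A + K)"
    using nonneg by (intro mult_right_mono) auto
  with bound[of 0] show ?thesis by simp
qed


section \<open>Crossing the boundary of an open set\<close>

lemma first_exit_time:
  fixes \<gamma> :: "real \<Rightarrow> 'a::metric_space"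
  assumes cont: "continuous_on {a..b} \<gamma>" and "a \<le> b" "open U" "\<gamma> a \<in> U" "\<gamma> b \<notin> U"
  shows "\<exists>c. a < c \<and> c \<le> b \<and> \<gamma> c \<in> frontier U \<and> (\<forall>t\<in>{a..<c}. \<gamma> t \<in> U)"
proof -
  define S where "S = {a..b} \<inter> \<gamma> -` (- U)"
  have "closed S"
    unfolding S_def using cont \<open>open U\<close> by (intro continuous_closed_preimage) auto
  then have "compact S"
    unfolding S_def using compact_Icc by (metis S_def bounded_Int bounded_closed_interval compact_eq_bounded_closed)
  moreover have "b \<in> S"
    using assms by (auto simp: S_def)
  ultimately obtain c where c: "c \<in> S" "\<And>t. t \<in> S \<Longrightarrow> c \<le> t"
    using compact_attains_inf[of S] by blast
  have cab: "a \<le> c" "c \<le> b" "\<gamma> c \<notin> U"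
    using c(1) by (auto simp: S_def)
  then have "a < c"
    using \<open>\<gamma> a \<in> U\<close> by (metis less_le)
  have before: "\<forall>t\<in>{a..<c}. \<gamma> t \<in> U"
    using c(2) cab by (force simp: S_def)
  have "\<gamma> ` closure {a..<c} \<subseteq> closure U"
    using before \<open>a < c\<close> cab
    by (intro image_closure_subset continuous_on_subset[OF cont]) (auto intro: subsetD[OF closure_subset])
  then have "\<gamma> c \<in> closure U"
    using \<open>a < c\<close> by auto
  then have "\<gamma> c \<in> frontier U"
    using cab \<open>open U\<close> by (simp add: frontier_def interior_open)
  with \<open>a < c\<close> cab before show ?thesis by blast
qed

lemma crosses_frontier:
  fixes \<gamma> :: "real \<Rightarrow> 'a::metric_space"
  assumes "continuous_on {a..b} \<gamma>" "a \<le> b" "\<gamma> a \<notin> U" "\<gamma> b \<in> U"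
  shows "\<exists>c. a \<le> c \<and> c \<le> b \<and> \<gamma> c \<in> frontier U"
proof -
  have "connected (\<gamma> ` {a..b})"
    using assms by (intro connected_continuous_image) auto
  then have "\<gamma> ` {a..b} \<inter> frontier U \<noteq> {}"
    using assms(2-) by (intro connected_Int_frontier) force+
  then show ?thesis by auto
qed

text \<open>
  On the reals a \<open>LEAST\<close> is meaningful only where the minimum is attained. Here it is, because
  \<open>\<gamma> 0 \<notin> F\<close> lets the open condition \<open>s > 0\<close> be replaced by the closed condition \<open>s \<ge> 0\<close>.
\<close>

lemma least_hitting_time:
  fixes \<gamma> :: "real \<Rightarrow> 'a::metric_space"
  assumes cont: "continuous_on UNIV \<gamma>" and "closed F" "\<gamma> 0 \<notin> F" "t \<ge> 0" "\<gamma> t \<in> F"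
  shows "(LEAST s. s > 0 \<and> \<gamma> s \<in> F) \<in> {0<..t}"
proof -
  define S where "S = {0..t} \<inter> \<gamma> -` F"
  have "closed S"
    unfolding S_def using cont \<open>closed F\<close>
    by (intro continuous_closed_preimage) (auto intro: continuous_on_subset)
  then have "compact S"
    unfolding S_def using compact_Icc by (metis S_def bounded_Int bounded_closed_interval compact_eq_bounded_closed)
  moreover have "t \<in> S"
    using assms by (auto simp: S_def)
  ultimately obtain m where m: "m \<in> S" "\<And>s. s \<in> S \<Longrightarrow> m \<le> s"
    using compact_attains_inf[of S] by blast
  have m': "0 < m" "m \<le> t" "\<gamma> m \<in> F"
    using m(1) \<open>\<gamma> 0 \<notin> F\<close> by (auto simp: S_def less_le)
  have "(LEAST s. s > 0 \<and> \<gamma> s \<in> F) = m"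
  proof (rule Least_equality)
    fix s assume s: "s > 0 \<and> \<gamma> s \<in> F"
    then show "m \<le> s"
      using m(2)[of s] m'(2) by (cases "s \<le> t") (auto simp: S_def)
  qed (use m' in auto)
  with m' show ?thesis by simp
qed

lemma frontier_ball_dist:
  fixes p :: "'a::metric_space"
  assumes "x \<in> frontier (ball p e)"
  shows "dist p x = e"
proof -
  have "x \<in> closure (ball p e)" "x \<notin> ball p e"
    using assms by (auto simp: frontier_def interior_open)
  moreover have "closure (ball p e) \<subseteq> cball p e"
    by (rule closure_minimal) auto
  ultimately show ?thesis by auto
qed


section \<open>Flows on compact metric spaces\<close>

locale compact_flow =
  fixes v :: "'a::metric_space \<Rightarrow> real \<Rightarrow> 'a"
  assumes compact_space: "compact (UNIV :: 'a set)" and flow: "is_flow v"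
begin

lemma flow_zero [simp]: "v x 0 = x"
  using flow by (simp add: is_flow_def)

lemma flow_add [simp]: "v (v x s) t = v x (s + t)"
  using flow by (simp add: is_flow_def)

lemma continuous_on_flow [continuous_intros]:
  assumes "continuous_on S f" "continuous_on S h"
  shows "continuous_on S (\<lambda>s. v (f s) (h s))"
proof -
  have "continuous_on UNIV (\<lambda>(x, t). v x t)"
    using flow by (simp add: is_flow_def)
  then have "continuous_on S ((\<lambda>(x, t). v x t) \<circ> (\<lambda>s. (f s, h s)))"
    using assms by (intro continuous_on_compose continuous_on_Pair) (auto intro: continuous_on_subset)
  then show ?thesis by (simp add: o_def)
qed

lemma uniformly_short_displacement:
  assumes "e > 0"
  obtains h where "h > 0" "\<And>x t. 0 \<le> t \<Longrightarrow> t \<le> h \<Longrightarrow> dist x (v x t) < e"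
proof -
  have "uniformly_continuous_on (UNIV \<times> {0..1::real}) (\<lambda>z. v (fst z) (snd z))"
    using compact_space
    by (intro compact_uniformly_continuous continuous_intros compact_Times) auto
  then obtain d where d: "d > 0"
      "\<And>z z'. z \<in> UNIV \<times> {0..1} \<Longrightarrow> z' \<in> UNIV \<times> {0..1} \<Longrightarrow> dist z' z < d \<Longrightarrow>
        dist (v (fst z') (snd z')) (v (fst z) (snd z)) < e"
    using assms unfolding uniformly_continuous_on_def by metis
  show thesis
  proof (rule that[of "min 1 (d / 2)"])
    fix x t assume t: "0 \<le> t" "t \<le> min 1 (d / 2)"
    have "dist (v (fst (x, 0::real)) (snd (x, 0::real))) (v (fst (x, t)) (snd (x, t))) < e"
      using t d(1) by (intro d(2)) (auto simp: dist_Pair_Pair dist_real_def)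
    then show "dist x (v x t) < e" by simp
  qed (use d in auto)
qed

end


section \<open>Lyapunov functions\<close>

locale lyapunov_flow = compact_flow v
  for v :: "'a::metric_space \<Rightarrow> real \<Rightarrow> 'a" +
  fixes g :: "'a \<Rightarrow> real"
  assumes lyapunov: "lyapunov_function v g"
begin

lemma continuous_on_lyapunov [continuous_intros]:
  "continuous_on S f \<Longrightarrow> continuous_on S (\<lambda>s. g (f s))"
  using lyapunov continuous_on_compose2[of UNIV g S f] by (auto simp: lyapunov_function_def)

lemma lyapunov_strict: "x \<notin> fixed_points v \<Longrightarrow> s < t \<Longrightarrow> g (v x t) < g (v x s)"
  using lyapunov by (simp add: lyapunov_function_def)

lemma lyapunov_mono: "s \<le> t \<Longrightarrow> g (v x t) \<le> g (v x s)"
  using lyapunov_strict[of x s t] by (cases "x \<in> fixed_points v"; cases "s = t") (auto simp: fixed_points_def)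

lemma lyapunov_le: "0 \<le> t \<Longrightarrow> g (v x t) \<le> g x"
  using lyapunov_mono[of 0 t x] by simp

lemma lyapunov_bounded:
  obtains G where "G > 0" "\<And>x. \<bar>g x\<bar> \<le> G"
proof -
  have "bounded (range g)"
    using compact_space by (intro compact_imp_bounded compact_continuous_image continuous_intros)
  with that show thesis by (auto simp: bounded_pos)
qed

text \<open>
  Away from the balls around the fixed points, \<open>g\<close> loses by compactness a definite amount \<open>\<kappa>\<close> in each
  unit of time, and \<open>g\<close> is bounded.
\<close>

lemma visits_fixed_points:
  assumes "e > 0"
  obtains T where "T > 0" "\<And>x. \<exists>\<tau>\<in>{0..T}. \<exists>p\<in>fixed_points v. v x \<tau> \<in> ball p e"
proof -
  define C where "C = - (\<Union>p\<in>fixed_points v. ball p e)"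
  have "compact C"
    unfolding C_def using compact_space by (metis Compl_eq_Diff_UNIV compact_diff open_UN open_ball)
  obtain \<kappa> where \<kappa>: "\<kappa> > 0" "\<And>x. x \<in> C \<Longrightarrow> g (v x 1) \<le> g x - \<kappa>"
  proof (cases "C = {}")
    case True
    then show thesis using that[of 1] by simp
  next
    case False
    have "continuous_on C (\<lambda>x. g x - g (v x 1))"
      by (intro continuous_intros)
    then obtain x0 where x0: "x0 \<in> C" "\<And>x. x \<in> C \<Longrightarrow> g x0 - g (v x0 1) \<le> g x - g (v x 1)"
      using continuous_attains_inf[OF \<open>compact C\<close> False] by blast
    have "x0 \<notin> fixed_points v"
      using x0(1) assms by (auto simp: C_def)
    then have "g (v x0 1) < g x0"
      using lyapunov_strict[of x0 0 1] by simp
    then show thesis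
      using that[of "g x0 - g (v x0 1)"] x0(2) by force
  qed
  obtain G where G: "G > 0" "\<And>x. \<bar>g x\<bar> \<le> G"
    using lyapunov_bounded by blast
  obtain N :: nat where N: "2 * G < real N * \<kappa>"
    using \<kappa>(1) reals_Archimedean3 by blast
  have leaves: "\<exists>i\<le>N. v x (real i) \<notin> C" for x
  proof (rule ccontr)
    assume "\<not> ?thesis"
    then have inC: "v x (real i) \<in> C" if "i \<le> N" for i using that by auto
    have "g (v x (real n)) \<le> g x - real n * \<kappa>" if "n \<le> N" for n
      using that
    proof (induction n)
      case (Suc n)
      then have "g (v x (real n + 1)) \<le> g (v x (real n)) - \<kappa>"
        using \<kappa>(2)[OF inC[of n]] by simp
      with Suc show ?case by (simp add: algebra_simps)
    qed simp
    from this[of N] N G(2)[of x] G(2)[of "v x (real N)"] show False by simp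
  qed
  have "\<exists>\<tau>\<in>{0..real (Suc N)}. \<exists>p\<in>fixed_points v. v x \<tau> \<in> ball p e" for x
  proof -
    obtain i where "i \<le> N" "v x (real i) \<notin> C"
      using leaves by blast
    then show ?thesis
      unfolding C_def by (intro bexI[of _ "real i"]) auto
  qed
  with that[of "real (Suc N)"] show thesis by simp
qed

text \<open>
  A trajectory that comes from outside and reaches the ball of radius \<open>r/4\<close> passes, after its last
  point \<open>x\<close> on the boundary of \<open>B\<^sub>r(p)\<close>, through the sphere of radius \<open>r/2\<close>. Such \<open>x\<close> are the points over
  which \<open>delta_plus\<close> takes the infimum; the factor \<open>2\<close> undoes the \<open>1/2\<close> in its definition.
\<close>

lemma entering_drop:
  assumes "r > 0" and D: "ereal D \<le> delta_plus v g r (r / 4) p"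
    and "u \<notin> ball p r" "\<tau> \<ge> 0" "v u \<tau> \<in> ball p (r / 4)"
  shows "g (v u \<tau>) + 2 * D \<le> g u"
proof -
  \<comment> \<open>The last point \<open>x\<close> before time \<open>\<tau>\<close> at which the trajectory is outside the ball.\<close>
  obtain c where c: "0 < c" "c \<le> \<tau>" "v u (\<tau> - c) \<in> frontier (ball p r)"
  proof -
    have "continuous_on {0..\<tau>} (\<lambda>t. v u (\<tau> - t))"
      by (intro continuous_intros)
    moreover have "v u (\<tau> - 0) \<in> ball p r" "v u (\<tau> - \<tau>) \<notin> ball p r"
      using assms by auto
    ultimately show thesis
      using first_exit_time[of 0 \<tau> "\<lambda>t. v u (\<tau> - t)" "ball p r"] \<open>\<tau> \<ge> 0\<close> that by blast
  qed
  define x where "x = v u (\<tau> - c)"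
  have x: "x \<in> frontier (ball p r)" and xc: "v x c = v u \<tau>"
    using c by (auto simp: x_def)
  have dist_x: "dist p x = r"
    using frontier_ball_dist[OF x] .
  have cross: "\<exists>t. 0 \<le> t \<and> t \<le> c \<and> v x t \<in> frontier (ball p e)" if "r / 4 \<le> e" "e < r" for e
  proof (rule crosses_frontier)
    show "continuous_on {0..c} (v x)"
      by (intro continuous_intros)
  qed (use that assms(5) dist_x c(1) xc in auto)
  have "x \<in> B_plus v r (r / 4) p"
  proof -
    obtain t where t: "0 \<le> t" "t \<le> c" "v x t \<in> frontier (ball p (r / 4))"
      using cross[of "r / 4"] \<open>r > 0\<close> by auto
    then have "v x t \<in> segment v x c"
      by (auto simp: segment_def closed_segment_eq_real_ivl)
    then show ?thesis
      using x t c(1) by (auto simp: B_plus_def)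
  qed
  then have "ereal D \<le> ereal ((g x - g (v x (t_plus v r p x))) / 2)"
    using D unfolding delta_plus_def by (meson INF_lower order_trans)
  then have drop: "2 * D \<le> g x - g (v x (t_plus v r p x))"
    by simp
  obtain t where t: "0 \<le> t" "t \<le> c" "v x t \<in> frontier (ball p (r / 2))"
    using cross[of "r / 2"] \<open>r > 0\<close> by auto
  have "v x 0 \<notin> frontier (ball p (r / 2))"
    using frontier_ball_dist[of x p "r / 2"] dist_x \<open>r > 0\<close> by auto
  then have "t_plus v r p x \<in> {0<..t}"
    unfolding t_plus_def using t by (intro least_hitting_time) (auto intro!: continuous_intros)
  then have "g (v u \<tau>) \<le> g (v x (t_plus v r p x))"
    using t(2) lyapunov_mono[of "t_plus v r p x" c x] by (simp add: xc)
  moreover have "g x \<le> g u"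
    unfolding x_def using c by (intro lyapunov_le) auto
  ultimately show ?thesis using drop by linarith
qed

lemma time_reversal: "lyapunov_flow (\<lambda>x t. v x (- t)) (\<lambda>x. - g x)"
proof
  have "fixed_points (\<lambda>x t. v x (- t)) = fixed_points v"
    unfolding fixed_points_def by (metis minus_minus)
  then show "lyapunov_function (\<lambda>x t. v x (- t)) (\<lambda>x. - g x)"
    unfolding lyapunov_function_def
    using lyapunov_strict by (auto intro!: continuous_on_minus continuous_on_lyapunov[of UNIV "\<lambda>x. x"])
  have "continuous_on UNIV (\<lambda>z. v (fst z) (- snd z))"
    by (intro continuous_intros)
  then show "is_flow (\<lambda>x t. v x (- t))"
    by (simp add: is_flow_def case_prod_beta)
qed (rule compact_space)

lemma delta_plus_time_reversal:
  "delta_plus (\<lambda>x t. v x (- t)) (\<lambda>x. - g x) r s p = delta_minus v g r s p"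
proof -
  have seg: "segment (\<lambda>x t. v x (- t)) x t = segment v x (- t)" for x t
  proof -
    have "closed_segment 0 (- t) = uminus ` closed_segment 0 t"
      by (auto simp: closed_segment_eq_real_ivl image_iff
          intro: bexI[of _ "- _"])
    then show ?thesis by (simp add: segment_def image_image)
  qed
  have negative_times: "(\<exists>t>0. Q (- t)) \<longleftrightarrow> (\<exists>t<0. Q t)" for Q :: "real \<Rightarrow> bool"
  proof safe
    fix t assume "t < 0" "Q t"
    then show "\<exists>t>0. Q (- t)" by (intro exI[of _ "- t"]) simp
  next
    fix t :: real assume "t > 0" "Q (- t)"
    then show "\<exists>t<0. Q t" by (intro exI[of _ "- t"]) simp
  qed
  have "B_plus (\<lambda>x t. v x (- t)) r s p = B_minus v r s p"
    by (simp add: B_plus_def B_minus_def seg negative_times[symmetric])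
  then show ?thesis
    unfolding delta_plus_def delta_minus_def t_plus_def t_minus_def by simp
qed

text \<open>
  This is \<open>entering_drop\<close> for the reversed flow, which has the Lyapunov function \<open>- g\<close>.
\<close>

lemma leaving_drop:
  assumes "r > 0" and D: "ereal D \<le> delta_minus v g r (r / 4) p"
    and "u \<in> ball p (r / 4)" "\<tau> \<ge> 0" "v u \<tau> \<notin> ball p r"
  shows "g (v u \<tau>) + 2 * D \<le> g u"
proof -
  interpret rev: lyapunov_flow "\<lambda>x t. v x (- t)" "\<lambda>x. - g x"
    by (rule time_reversal)
  show ?thesis
    using rev.entering_drop[of r D p "v u \<tau>" \<tau>] assms
    by (simp add: delta_plus_time_reversal)
qed

end

locale finite_lyapunov_flow = lyapunov_flow v g
  for v :: "'a::metric_space \<Rightarrow> real \<Rightarrow> 'a" and g :: "'a \<Rightarrow> real" +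
  fixes r :: real
  assumes finite_fixed: "finite (fixed_points v)" and r_pos: "r > 0"
    and disjoint: "disjoint_family_on (\<lambda>p. g ` ball p r) (fixed_points v)"
begin

lemma values_disjoint:
  assumes "p \<in> fixed_points v" "q \<in> fixed_points v" "p \<noteq> q" "x \<in> ball p r" "y \<in> ball q r"
  shows "g x \<noteq> g y"
  using disjoint assms unfolding disjoint_family_on_def by blast

lemma inj_on_fixed_points: "inj_on g (fixed_points v)"
proof (rule inj_onI, rule ccontr)
  fix p q assume "p \<in> fixed_points v" "q \<in> fixed_points v" "g p = g q" "p \<noteq> q"
  then show False
    using values_disjoint[of p q p q] r_pos by simp
qed

lemma delta0_lower:
  assumes "ereal D \<le> delta0 v g r" "p \<in> fixed_points v"
  shows "ereal D \<le> delta_plus v g r (r / 4) p" "ereal D \<le> delta_minus v g r (r / 4) p"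
proof -
  have "delta0 v g r \<le> min (delta_plus v g r (r / 4) p) (delta_minus v g r (r / 4) p)"
    unfolding delta0_def using finite_fixed assms(2) by (intro Min_le) auto
  with assms(1) have "ereal D \<le> min (delta_plus v g r (r / 4) p) (delta_minus v g r (r / 4) p)"
    by (rule order_trans)
  then show "ereal D \<le> delta_plus v g r (r / 4) p" "ereal D \<le> delta_minus v g r (r / 4) p"
    by auto
qed

text \<open>
  A point \<open>y\<close> outside \<open>B\<^bsub>r/2\<^esub>(p)\<close> with \<open>g y \<le> g p\<close> flows into \<open>B\<^sub>r(q)\<close> for some fixed point \<open>q \<noteq> p\<close>: if \<open>y\<close>
  is not itself such a \<open>q\<close>, then \<open>g\<close> falls strictly below \<open>g p\<close>, and the next fixed point that is closely
  approached cannot be \<open>p\<close>. By disjointness the trajectory is then outside \<open>B\<^sub>r(p)\<close>. Entering \<open>B\<^sub>r(q)\<close> is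
  an open condition on \<open>y\<close>, so by compactness it still holds when \<open>g y\<close> exceeds \<open>g p\<close> slightly, as it
  may for points on trajectories that start close to \<open>p\<close>.
\<close>

lemma half_ball_exit_is_final:
  assumes p: "p \<in> fixed_points v"
  obtains e where "e > 0"
    "\<And>u \<tau>. u \<in> ball p e \<Longrightarrow> \<tau> \<ge> 0 \<Longrightarrow> v u \<tau> \<notin> ball p (r / 2) \<Longrightarrow> \<exists>t\<ge>0. v u t \<notin> ball p r"
proof -
  \<comment> \<open>\<open>W\<close> collects the points that reach the \<open>r\<close>-ball of another fixed point. On the compact set \<open>C\<close> of
    the remaining points outside \<open>B\<^bsub>r/2\<^esub>(p)\<close>, \<open>g\<close> is bounded below by some \<open>m > g p\<close>.\<close>
  define W where "W = (\<Union>q\<in>fixed_points v - {p}. \<Union>t\<in>{0..}. (\<lambda>y. v y t) -` ball q r)"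
  define C where "C = - (W \<union> ball p (r / 2))"
  have "open W"
    unfolding W_def by (intro open_UN ballI open_vimage continuous_intros) auto
  then have "compact C"
    unfolding C_def using compact_space by (metis Compl_eq_Diff_UNIV compact_diff open_Un open_ball)
  have above: "g p < g y" if y: "y \<in> C" for y
  proof (rule ccontr)
    assume "\<not> g p < g y"
    then have le: "g y \<le> g p" by simp
    have "y \<noteq> p"
      using y r_pos by (auto simp: C_def)
    have nonfixed: "y \<notin> fixed_points v"
    proof
      assume "y \<in> fixed_points v"
      then have "y \<in> W"
        using \<open>y \<noteq> p\<close> r_pos unfolding W_def by (force intro!: bexI[of _ y] bexI[of _ 0])
      then show False using y by (simp add: C_def)
    qed
    have lt: "g (v y 1) < g p"
      using lyapunov_strict[OF nonfixed, of 0 1] le by simp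
    have "open (g -` {g (v y 1)<..})"
      by (intro open_vimage continuous_on_lyapunov) (auto intro: continuous_intros)
    then obtain d where d: "d > 0" "ball p d \<subseteq> g -` {g (v y 1)<..}"
      using lt by (auto elim!: openE)
    obtain \<tau> q where \<tau>: "\<tau> \<ge> 0" "q \<in> fixed_points v" "v (v y 1) \<tau> \<in> ball q (min d r)"
      using visits_fixed_points[of "min d r"] d(1) r_pos
      by (metis atLeastAtMost_iff min_less_iff_conj)
    have "q \<noteq> p"
      using \<tau> d(2) lyapunov_le[of \<tau> "v y 1"] by force
    then have "y \<in> W"
      using \<tau> unfolding W_def by (force intro!: bexI[of _ q] bexI[of _ "1 + \<tau>"])
    then show False using y by (simp add: C_def)
  qed
  obtain m where m: "g p < m" "\<And>y. y \<in> C \<Longrightarrow> m \<le> g y"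
  proof (cases "C = {}")
    case True
    then show thesis using that[of "g p + 1"] by simp
  next
    case False
    have "continuous_on C g"
      using continuous_on_lyapunov[of C "\<lambda>x. x"] by (simp add: continuous_intros)
    then obtain x0 where "x0 \<in> C" "\<And>y. y \<in> C \<Longrightarrow> g x0 \<le> g y"
      using continuous_attains_inf[OF \<open>compact C\<close> False] by metis
    then show thesis using that above by blast
  qed
  have "open (g -` {..<m})"
    by (intro open_vimage continuous_on_lyapunov) (auto intro: continuous_intros)
  then obtain e where e: "e > 0" "ball p e \<subseteq> g -` {..<m}"
    using m(1) by (auto elim!: openE)
  show thesis
  proof (rule that[OF e(1)])
    fix u \<tau> assume u: "u \<in> ball p e" "\<tau> \<ge> 0" "v u \<tau> \<notin> ball p (r / 2)"
    have "g (v u \<tau>) < m"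
      using u e(2) lyapunov_le[of \<tau> u] by force
    then have "v u \<tau> \<notin> C"
      using m(2) by force
    then have "v u \<tau> \<in> W"
      using u by (simp add: C_def)
    then obtain q t where qt: "q \<in> fixed_points v" "q \<noteq> p" "t \<ge> 0" "v u (\<tau> + t) \<in> ball q r"
      by (auto simp: W_def)
    then have "v u (\<tau> + t) \<notin> ball p r"
      using values_disjoint[OF p qt(1)] by blast
    then show "\<exists>t\<ge>0. v u t \<notin> ball p r"
      using qt(3) u(2) by (metis add_nonneg_nonneg)
  qed
qed

end

section \<open>Integrals of a cocycle along trajectories\<close>

locale flow_cocycle = compact_flow v
  for v :: "'a::metric_space \<Rightarrow> real \<Rightarrow> 'a" +
  fixes \<alpha> :: "'a \<times> 'a \<Rightarrow> real" and r A :: real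
  assumes covering: "associated_covering \<alpha> r" and cocycle_bound: "\<And>z. \<bar>\<alpha> z\<bar> \<le> A"
begin

lemma radius_pos: "r > 0"
  using covering by (simp add: associated_covering_def)

lemma bound_nonneg: "0 \<le> A"
  using cocycle_bound[of undefined] by linarith

lemma cocycle_add:
  assumes "x \<in> closure (ball c r)" "y \<in> closure (ball c r)" "z \<in> closure (ball c r)"
  shows "\<alpha> (x, y) + \<alpha> (y, z) = \<alpha> (x, z)"
proof -
  obtain \<beta> :: "'a \<Rightarrow> real"
    where "\<forall>x \<in> closure (ball c r). \<forall>y \<in> closure (ball c r). \<alpha> (x, y) = \<beta> y - \<beta> x"
    using covering unfolding associated_covering_def by metis
  with assms show ?thesis by simp
qed

lemma cocycle_diag [simp]: "\<alpha> (x, x) = 0"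
proof -
  have "x \<in> closure (ball x r)"
    using radius_pos closure_subset by fastforce
  from cocycle_add[OF this this this] show ?thesis by simp
qed

lemma short_arcs:
  obtains h where "h > 0" "\<And>x a b. a \<le> b \<Longrightarrow> b \<le> a + h \<Longrightarrow> v x ` {a..b} \<subseteq> ball (v x a) r"
proof -
  obtain h where h: "h > 0" "\<And>x t. 0 \<le> t \<Longrightarrow> t \<le> h \<Longrightarrow> dist x (v x t) < r"
    using uniformly_short_displacement[OF radius_pos] by blast
  have "v x ` {a..b} \<subseteq> ball (v x a) r" if "b \<le> a + h" for x a b
  proof
    fix y assume "y \<in> v x ` {a..b}"
    then obtain t where t: "t \<in> {a..b}" "y = v x t" by blast
    then show "y \<in> ball (v x a) r"
      using h(2)[of "t - a" "v x a"] that by simp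
  qed
  with h(1) that show thesis by blast
qed

text \<open>
  A function on the time axis that integrates \<open>\<alpha>\<close> along the trajectory of \<open>x\<close>. Closed balls are used,
  so that an arc that ends at its exit point from a ball is covered as well.
\<close>

definition primitive_along :: "'a \<Rightarrow> real \<Rightarrow> (real \<Rightarrow> real) \<Rightarrow> bool" where
  "primitive_along x b F \<longleftrightarrow>
     (\<forall>s t c. 0 \<le> s \<longrightarrow> s \<le> t \<longrightarrow> t \<le> b \<longrightarrow> v x ` {s..t} \<subseteq> closure (ball c r) \<longrightarrow>
        F t - F s = \<alpha> (v x s, v x t))"

lemma primitive_along_diff:
  assumes "primitive_along x b F" "0 \<le> s" "s \<le> t" "t \<le> b" "v x ` {s..t} \<subseteq> closure (ball c r)"
  shows "F t - F s = \<alpha> (v x s, v x t)"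
  using assms unfolding primitive_along_def by blast

lemma primitive_along_shorter: "primitive_along x b F \<Longrightarrow> a \<le> b \<Longrightarrow> primitive_along x a F"
  unfolding primitive_along_def by (meson order_trans)

text \<open>
  A primitive is extended by arcs of a fixed length \<open>h\<close>. An arc that straddles the seam \<open>m\<close> lies in one
  ball, where the cocycle identity applies to its two halves.
\<close>

lemma primitive_along_exists: "\<exists>F. primitive_along x b F"
proof -
  obtain h where h: "h > 0" "\<And>x a b. a \<le> b \<Longrightarrow> b \<le> a + h \<Longrightarrow> v x ` {a..b} \<subseteq> ball (v x a) r"
    using short_arcs by blast
  have "\<exists>F. primitive_along x (real n * h) F" for n
  proof (induction n)
    case 0
    have "primitive_along x 0 (\<lambda>_. 0)"
      unfolding primitive_along_def by (auto dest: order_antisym)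
    then show ?case by auto
  next
    case (Suc n)
    then obtain F where F: "primitive_along x (real n * h) F" by blast
    define m where "m = real n * h"
    have "m \<ge> 0"
      using h(1) by (simp add: m_def)
    define F' where "F' t = (if t \<le> m then F t else F m + \<alpha> (v x m, v x t))" for t
    have "F' t - F' s = \<alpha> (v x s, v x t)"
      if st: "0 \<le> s" "s \<le> t" "t \<le> real (Suc n) * h" and c: "v x ` {s..t} \<subseteq> closure (ball c r)" for s t c
    proof -
      consider "t \<le> m" | "s \<le> m" "m < t" | "m < s" using st by linarith
      then show ?thesis
      proof cases
        case 1
        then show ?thesis
          using primitive_along_diff[OF F st(1,2) _ c] st by (simp add: F'_def m_def)
      next
        case 2
        then have "v x ` {s..m} \<subseteq> closure (ball c r)"
          using c by auto
        then have "F m - F s = \<alpha> (v x s, v x m)"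
          using primitive_along_diff[OF F st(1) 2(1)] by (simp add: m_def)
        moreover have "\<alpha> (v x s, v x m) + \<alpha> (v x m, v x t) = \<alpha> (v x s, v x t)"
          using c st 2 by (intro cocycle_add[of _ c]) auto
        ultimately show ?thesis
          using 2 by (simp add: F'_def)
      next
        case 3
        have "t \<le> m + h"
          using st(3) by (simp add: m_def algebra_simps)
        then have "v x ` {m..t} \<subseteq> closure (ball (v x m) r)"
          using h(2)[of m t x] st 3 closure_subset[of "ball (v x m) r"] by auto
        then have "\<alpha> (v x m, v x s) + \<alpha> (v x s, v x t) = \<alpha> (v x m, v x t)"
          using st 3 by (intro cocycle_add[of _ "v x m"]) auto
        then show ?thesis
          using 3 st by (simp add: F'_def)
      qed
    qed
    then show ?case
      unfolding primitive_along_def by blast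
  qed
  then obtain F n where "primitive_along x (real n * h) F" "b \<le> real n * h"
    using h(1) by (metis ex_less_of_nat_mult less_imp_le)
  then show ?thesis
    using primitive_along_shorter by blast
qed

abbreviation trajectory_integral :: "'a \<Rightarrow> real \<Rightarrow> real" where
  "trajectory_integral x \<equiv> curve_integral \<alpha> r (v x) 0"

text \<open>
  With a primitive at hand, the sum over any fine subdivision telescopes. This shows that the
  integral is well defined without passing to common refinements.
\<close>

lemma fine_subdivision_sum:
  assumes F: "primitive_along x b F" and fine: "fine_subdivision r (v x) 0 b N \<tau>"
  shows "(\<Sum>i<N. \<alpha> (v x (\<tau> i), v x (\<tau> (Suc i)))) = F b - F 0"
proof -
  have mono: "\<tau> i \<le> \<tau> j" if "i \<le> j" "j \<le> N" for i j
    using that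
  proof (induction j rule: dec_induct)
    case (step j)
    then have "\<tau> j < \<tau> (Suc j)"
      using fine by (simp add: fine_subdivision_def)
    with step show ?case by simp
  qed simp
  have "\<alpha> (v x (\<tau> i), v x (\<tau> (Suc i))) = F (\<tau> (Suc i)) - F (\<tau> i)" if iN: "i < N" for i
  proof -
    obtain c where "v x ` {\<tau> i..\<tau> (Suc i)} \<subseteq> ball c r"
      using fine iN unfolding fine_subdivision_def by blast
    then have arc: "v x ` {\<tau> i..\<tau> (Suc i)} \<subseteq> closure (ball c r)"
      using closure_subset by (rule order_trans)
    have "0 \<le> \<tau> i" "\<tau> i \<le> \<tau> (Suc i)" "\<tau> (Suc i) \<le> b"
      using mono[of 0 i] mono[of i "Suc i"] mono[of "Suc i" N] iN fine
      by (simp_all add: fine_subdivision_def)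
    from primitive_along_diff[OF F this arc] show ?thesis by simp
  qed
  then have "(\<Sum>i<N. \<alpha> (v x (\<tau> i), v x (\<tau> (Suc i)))) = (\<Sum>i<N. F (\<tau> (Suc i)) - F (\<tau> i))"
    by (intro sum.cong) auto
  also have "\<dots> = F (\<tau> N) - F (\<tau> 0)"
    by (rule sum_lessThan_telescope)
  finally show ?thesis
    using fine by (simp add: fine_subdivision_def)
qed

lemma fine_subdivision_exists:
  assumes "b \<ge> 0"
  shows "\<exists>N \<tau>. fine_subdivision r (v x) 0 b N \<tau>"
proof (cases "b = 0")
  case True
  then have "fine_subdivision r (v x) 0 b 0 (\<lambda>_. 0)"
    by (simp add: fine_subdivision_def)
  then show ?thesis by blast
next
  case False
  with assms have "b > 0" by simp
  obtain h where h: "h > 0" "\<And>x a b. a \<le> b \<Longrightarrow> b \<le> a + h \<Longrightarrow> v x ` {a..b} \<subseteq> ball (v x a) r"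
    using short_arcs by blast
  obtain N :: nat where N: "b < real N * h"
    using ex_less_of_nat_mult[OF h(1)] by blast
  then have "N > 0"
    using \<open>b > 0\<close> by (cases N) auto
  define \<tau> where "\<tau> i = real i * (b / real N)" for i
  have step: "\<tau> (Suc i) = \<tau> i + b / real N" for i
    by (simp add: \<tau>_def algebra_simps add_divide_distrib)
  have "0 < b / real N" "b / real N \<le> h"
    using N \<open>N > 0\<close> \<open>b > 0\<close> by (auto simp: field_simps)
  then have "\<tau> i < \<tau> (Suc i)" "v x ` {\<tau> i..\<tau> (Suc i)} \<subseteq> ball (v x (\<tau> i)) r" for i
    using h(2)[of "\<tau> i" "\<tau> (Suc i)" x] by (simp_all add: step)
  moreover have "\<tau> 0 = 0" "\<tau> N = b"
    using \<open>N > 0\<close> by (simp_all add: \<tau>_def)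
  ultimately have "fine_subdivision r (v x) 0 b N \<tau>"
    unfolding fine_subdivision_def by blast
  then show ?thesis by blast
qed

lemma trajectory_integral_primitive:
  assumes F: "primitive_along x b F" and "b \<ge> 0"
  shows "trajectory_integral x b = F b - F 0"
  unfolding curve_integral_def
proof (rule the_equality)
  show "\<forall>N \<tau>. fine_subdivision r (v x) 0 b N \<tau> \<longrightarrow>
      F b - F 0 = (\<Sum>i<N. \<alpha> (v x (\<tau> i), v x (\<tau> (Suc i))))"
    using fine_subdivision_sum[OF F] by auto
next
  fix I
  assume I: "\<forall>N \<tau>. fine_subdivision r (v x) 0 b N \<tau> \<longrightarrow>
      I = (\<Sum>i<N. \<alpha> (v x (\<tau> i), v x (\<tau> (Suc i))))"
  obtain N \<tau> where "fine_subdivision r (v x) 0 b N \<tau>"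
    using fine_subdivision_exists[OF \<open>b \<ge> 0\<close>] by metis
  then show "I = F b - F 0"
    using I fine_subdivision_sum[OF F] by metis
qed

lemma trajectory_integral_zero [simp]: "trajectory_integral x 0 = 0"
  using primitive_along_exists[of x 0] trajectory_integral_primitive[of x 0] by auto

lemma trajectory_integral_diff:
  assumes "0 \<le> a" "a \<le> b" "v x ` {a..b} \<subseteq> closure (ball c r)"
  shows "trajectory_integral x b - trajectory_integral x a = \<alpha> (v x a, v x b)"
proof -
  obtain F where F: "primitive_along x b F"
    using primitive_along_exists by blast
  then have "primitive_along x a F"
    using assms(2) by (rule primitive_along_shorter)
  then show ?thesis
    using trajectory_integral_primitive[OF F] trajectory_integral_primitive[of x a F]
      primitive_along_diff[OF F assms(1,2) order_refl assms(3)] assms by simp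
qed

lemma trajectory_integral_bounded_time:
  obtains K where "K \<ge> 0"
    "\<And>x a b. 0 \<le> a \<Longrightarrow> a \<le> b \<Longrightarrow> b \<le> a + T \<Longrightarrow>
       \<bar>trajectory_integral x b - trajectory_integral x a\<bar> \<le> K"
proof -
  obtain h where h: "h > 0" "\<And>x a b. a \<le> b \<Longrightarrow> b \<le> a + h \<Longrightarrow> v x ` {a..b} \<subseteq> ball (v x a) r"
    using short_arcs by blast
  have short: "\<bar>trajectory_integral x b - trajectory_integral x a\<bar> \<le> A"
    if "0 \<le> a" "a \<le> b" "b \<le> a + h" for x a b
  proof -
    have "v x ` {a..b} \<subseteq> closure (ball (v x a) r)"
      using h(2)[of a b x] that closure_subset[of "ball (v x a) r"] by auto
    then show ?thesis
      using trajectory_integral_diff[OF that(1,2)] cocycle_bound by simp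
  qed
  have steps: "\<bar>trajectory_integral x b - trajectory_integral x a\<bar> \<le> real n * A"
    if "0 \<le> a" "a \<le> b" "b \<le> a + real n * h" for x a b n
    using that
  proof (induction n arbitrary: b)
    case (Suc n)
    define m where "m = max a (b - h)"
    have "\<bar>trajectory_integral x m - trajectory_integral x a\<bar> \<le> real n * A"
      using Suc.prems h(1) by (intro Suc.IH) (auto simp: m_def algebra_simps)
    moreover have "\<bar>trajectory_integral x b - trajectory_integral x m\<bar> \<le> A"
      using Suc.prems h(1) by (intro short) (auto simp: m_def)
    ultimately show ?case by (simp add: algebra_simps)
  qed simp
  obtain N :: nat where N: "T < real N * h"
    using ex_less_of_nat_mult[OF h(1)] by blast
  show thesis
  proof (rule that[of "real N * A"])
    show "0 \<le> real N * A"
      using bound_nonneg by simp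
    fix x a b assume "0 \<le> a" "a \<le> b" "b \<le> a + T"
    then show "\<bar>trajectory_integral x b - trajectory_integral x a\<bar> \<le> real N * A"
      using N by (intro steps) auto
  qed
qed

end


section \<open>Links between neighbourhoods of fixed points\<close>

context finite_lyapunov_flow
begin

text \<open>
  The intermediate value theorem on the part of the trajectory before it leaves the ball. The value
  at the exit point is itself at most \<open>g u - 2 D\<close>, so \<open>w\<close> is attained strictly before.
\<close>

lemma leaving_covers_values:
  assumes D: "ereal D \<le> delta0 v g r" and p: "p \<in> fixed_points v"
    and u: "u \<in> ball p (r / 4)" "\<tau> \<ge> 0" "v u \<tau> \<notin> ball p r"
    and w: "g u - 2 * D < w" "w \<le> g u"
  shows "w \<in> g ` ball p r"
proof -
  have "continuous_on {0..\<tau>} (v u)"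
    by (intro continuous_intros)
  moreover have "v u 0 \<in> ball p r"
    using u r_pos by simp
  ultimately obtain c where c: "0 < c" "v u c \<in> frontier (ball p r)" "\<forall>t\<in>{0..<c}. v u t \<in> ball p r"
    using first_exit_time[of 0 \<tau> "v u" "ball p r"] u by blast
  have "v u c \<notin> ball p r"
    using frontier_ball_dist[OF c(2)] by simp
  then have "g (v u c) + 2 * D \<le> g u"
    using leaving_drop[OF r_pos delta0_lower(2)[OF D p] u(1)] c(1) by simp
  then have "g (v u c) < w"
    using w(1) by linarith
  moreover have "continuous_on {0..c} (\<lambda>t. g (v u t))"
    by (intro continuous_intros)
  ultimately obtain t where t: "0 \<le> t" "t \<le> c" "g (v u t) = w"
    using IVT2'[of "\<lambda>t. g (v u t)" c w 0] w(2) c(1) by auto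
  then have "t < c"
    using \<open>g (v u c) < w\<close> by (cases "t = c") auto
  with t c(3) show ?thesis by auto
qed

end

text \<open>
  The scales of the argument. \<open>D\<close> is a finite lower bound of \<open>\<delta>\<^sub>0(r)\<close>, which may be infinite; \<open>\<omega>\<close> bounds
  the change of \<open>g\<close> in a jump; \<open>\<epsilon>\<close> is the radius in which visits to fixed points are recorded, and \<open>\<eta>\<close>
  is the error made on replacing \<open>g\<close> at a visit by its value at the fixed point. With \<open>\<omega>\<close> and \<open>\<eta>\<close> at
  most \<open>D/3\<close>, one passage through a shell outweighs up to two jumps and four such errors:
  \<open>2 \<omega> + 4 \<eta> < 2 D\<close>.
\<close>

locale linked_flow = finite_lyapunov_flow v g r
  for v :: "'a::metric_space \<Rightarrow> real \<Rightarrow> 'a" and g :: "'a \<Rightarrow> real" and r :: real +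
  fixes D \<omega> \<eta> \<epsilon> :: real
  assumes D: "ereal D \<le> delta0 v g r"
    and \<omega>: "0 \<le> \<omega>" "3 * \<omega> < D"
    and \<eta>: "0 < \<eta>" "3 * \<eta> \<le> D"
    and \<epsilon>: "0 < \<epsilon>" "\<epsilon> \<le> r / 4"
    and gap: "\<And>p q. p \<in> fixed_points v \<Longrightarrow> q \<in> fixed_points v \<Longrightarrow> p \<noteq> q \<Longrightarrow> \<eta> \<le> \<bar>g p - g q\<bar>"
    and near: "\<And>p u. p \<in> fixed_points v \<Longrightarrow> u \<in> ball p \<epsilon> \<Longrightarrow> \<bar>g u - g p\<bar> < \<eta>"
    and escape: "\<And>p u \<tau>. p \<in> fixed_points v \<Longrightarrow> u \<in> ball p \<epsilon> \<Longrightarrow> \<tau> \<ge> 0 \<Longrightarrow>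
        v u \<tau> \<notin> ball p (r / 2) \<Longrightarrow> \<exists>t\<ge>0. v u t \<notin> ball p r"
begin

text \<open>
  Two consecutive visits of a chain: from \<open>u\<close> near \<open>p\<close> the flow runs for time \<open>\<tau>\<close>, then comes a jump
  to \<open>z\<close>, and from there the flow runs for time \<open>\<sigma>\<close> to a point near \<open>q\<close>.
\<close>

definition link :: "'a \<Rightarrow> 'a \<Rightarrow> real \<Rightarrow> 'a \<Rightarrow> real \<Rightarrow> 'a \<Rightarrow> bool" where
  "link p u \<tau> z \<sigma> q \<longleftrightarrow>
     p \<in> fixed_points v \<and> u \<in> ball p \<epsilon> \<and> 0 \<le> \<tau> \<and>
     dist (v u \<tau>) z < r / 2 \<and> \<bar>g (v u \<tau>) - g z\<bar> \<le> \<omega> \<and>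
     0 \<le> \<sigma> \<and> v z \<sigma> \<in> ball q \<epsilon> \<and> q \<in> fixed_points v"

lemma small_ball: "x \<in> ball p \<epsilon> \<Longrightarrow> x \<in> ball p (r / 4)"
  using \<epsilon> by simp

lemma link_values:
  assumes "link p u \<tau> z \<sigma> q"
  shows "\<bar>g u - g p\<bar> < \<eta>" "\<bar>g (v z \<sigma>) - g q\<bar> < \<eta>" "\<bar>g (v u \<tau>) - g z\<bar> \<le> \<omega>"
    "g (v u \<tau>) \<le> g u" "g (v z \<sigma>) \<le> g z"
  using assms near lyapunov_le unfolding link_def by blast+

lemma link_increase:
  assumes "link p u \<tau> z \<sigma> q"
  shows "g q < g p + \<omega> + 2 * \<eta>"
  using link_values[OF assms] by linarith

text \<open>
  Leaving or entering \<open>B\<^sub>r(p)\<close> on the way would lower \<open>g\<close> by \<open>2 D\<close>, more than the jump and the two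
  errors \<open>\<eta>\<close> at the ends allow.
\<close>

lemma link_stay:
  assumes l: "link p u \<tau> z \<sigma> p"
  shows "v u ` {0..\<tau>} \<subseteq> ball p r" "v z ` {0..\<sigma>} \<subseteq> ball p r"
proof -
  note lv = link_values[OF l]
  have p: "p \<in> fixed_points v" and u: "u \<in> ball p (r / 4)" and zs: "v z \<sigma> \<in> ball p (r / 4)"
    using l small_ball by (auto simp: link_def)
  have "v u s \<in> ball p r" if s: "0 \<le> s" "s \<le> \<tau>" for s
  proof (rule ccontr)
    assume "v u s \<notin> ball p r"
    then have "g (v u s) + 2 * D \<le> g u"
      using leaving_drop[OF r_pos delta0_lower(2)[OF D p] u s(1)] by simp
    moreover have "g (v u \<tau>) \<le> g (v u s)"
      using s by (intro lyapunov_mono)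
    ultimately show False
      using lv \<omega> \<eta> by linarith
  qed
  then show "v u ` {0..\<tau>} \<subseteq> ball p r" by auto
  have "v z s \<in> ball p r" if s: "0 \<le> s" "s \<le> \<sigma>" for s
  proof (rule ccontr)
    assume "v z s \<notin> ball p r"
    then have "g (v (v z s) (\<sigma> - s)) + 2 * D \<le> g (v z s)"
      using s zs by (intro entering_drop[OF r_pos delta0_lower(1)[OF D p]]) auto
    moreover have "g (v z s) \<le> g z"
      using s by (intro lyapunov_le)
    ultimately show False
      using lv \<omega> \<eta> by simp
  qed
  then show "v z ` {0..\<sigma>} \<subseteq> ball p r" by auto
qed

text \<open>
  The fixed point \<open>b\<close> is the one from which the chain climbed to \<open>p\<close>. Since \<open>g b\<close> is so close to \<open>g p\<close>,
  no trajectory can leave \<open>B\<^sub>r(p)\<close> from near \<open>p\<close> without attaining the value \<open>g b\<close> there, which belongs to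
  \<open>g ` B\<^sub>r(b)\<close>. So the chain leaves \<open>p\<close> by a jump only, and pays \<open>2 D\<close> to enter \<open>B\<^sub>r(q)\<close> from outside.
\<close>

lemma link_rebound:
  assumes l: "link p u \<tau> z \<sigma> q" and "q \<noteq> p"
    and b: "b \<in> fixed_points v" "g b < g p" "g p < g b + \<omega> + 2 * \<eta>"
  shows "g q < g b"
proof -
  note lv = link_values[OF l]
  have p: "p \<in> fixed_points v" and u: "u \<in> ball p \<epsilon>" and \<tau>: "0 \<le> \<tau>" and q: "q \<in> fixed_points v"
    and zs: "v z \<sigma> \<in> ball q (r / 4)" "0 \<le> \<sigma>" and jump: "dist (v u \<tau>) z < r / 2"
    using l small_ball by (auto simp: link_def)
  have b_gap: "\<eta> \<le> g p - g b"
    using gap[OF p b(1)] b(2) by (cases "p = b") auto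
  have trapped: "v u t \<in> ball p r" if "0 \<le> t" for t
  proof (rule ccontr)
    assume "v u t \<notin> ball p r"
    then have "g b \<in> g ` ball p r"
      using lv b b_gap \<omega> \<eta> that
      by (intro leaving_covers_values[OF D p small_ball[OF u]]) auto
    moreover have "b \<in> ball b r" "b \<noteq> p"
      using r_pos b(2) by auto
    ultimately show False
      using values_disjoint[OF p b(1)] by (metis imageE)
  qed
  then have "v u \<tau> \<in> ball p (r / 2)"
    using escape[OF p u \<tau>] by blast
  then have "z \<in> ball p r"
    using jump dist_triangle[of p z "v u \<tau>"] by simp
  then have "z \<notin> ball q r"
    using values_disjoint[OF p q] \<open>q \<noteq> p\<close> by blast
  then have "g (v z \<sigma>) + 2 * D \<le> g z"
    using entering_drop[OF r_pos delta0_lower(1)[OF D q]] zs by blast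
  then show ?thesis
    using lv b \<omega> \<eta> by linarith
qed

end

text \<open>
  The conditions on \<open>\<eta>\<close> and \<open>\<epsilon>\<close> are finitely many, one for each fixed point or pair of fixed points,
  and each holds for all small enough positive values.
\<close>

lemma (in finite_lyapunov_flow) linked_flow_exists:
  assumes D: "ereal D \<le> delta0 v g r" and \<omega>: "0 \<le> \<omega>" "3 * \<omega> < D"
  obtains \<eta> \<epsilon> where "linked_flow v g r D \<omega> \<eta> \<epsilon>"
proof -
  have "\<forall>\<^sub>F \<eta> in at_right 0. \<forall>p\<in>fixed_points v. \<forall>q\<in>fixed_points v. p \<noteq> q \<longrightarrow> \<eta> \<le> \<bar>g p - g q\<bar>"
  proof (intro eventually_ball_finite[OF finite_fixed] ballI)
    fix p q assume pq: "p \<in> fixed_points v" "q \<in> fixed_points v"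
    show "\<forall>\<^sub>F \<eta> in at_right 0. p \<noteq> q \<longrightarrow> \<eta> \<le> \<bar>g p - g q\<bar>"
    proof (cases "p = q")
      case False
      then have "0 < \<bar>g p - g q\<bar>"
        using inj_on_fixed_points pq by (auto dest: inj_onD)
      then have "\<forall>\<^sub>F \<eta> in at_right 0. \<eta> < \<bar>g p - g q\<bar>"
        by (rule eventually_at_rightI[rotated]) auto
      then show ?thesis by eventually_elim auto
    qed simp
  qed
  moreover have "\<forall>\<^sub>F \<eta> in at_right 0. \<eta> < D / 3"
    using \<omega> by (intro eventually_at_rightI[of 0 "D / 3"]) auto
  moreover have "\<forall>\<^sub>F \<eta> in at_right (0::real). 0 < \<eta>"
    by (rule eventually_at_right_less)
  ultimately have "\<forall>\<^sub>F \<eta> in at_right 0. 0 < \<eta> \<and> 3 * \<eta> \<le> D \<and>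
      (\<forall>p\<in>fixed_points v. \<forall>q\<in>fixed_points v. p \<noteq> q \<longrightarrow> \<eta> \<le> \<bar>g p - g q\<bar>)"
    by eventually_elim auto
  from eventually_happens'[OF trivial_limit_at_right_real this] obtain \<eta> where \<eta>: "0 < \<eta>" "3 * \<eta> \<le> D"
      "\<forall>p\<in>fixed_points v. \<forall>q\<in>fixed_points v. p \<noteq> q \<longrightarrow> \<eta> \<le> \<bar>g p - g q\<bar>"
    by blast
  have "\<forall>\<^sub>F \<epsilon> in at_right 0. \<forall>p\<in>fixed_points v.
      (\<forall>u\<in>ball p \<epsilon>. \<bar>g u - g p\<bar> < \<eta>) \<and>
      (\<forall>u\<in>ball p \<epsilon>. \<forall>\<tau>\<ge>0. v u \<tau> \<notin> ball p (r / 2) \<longrightarrow> (\<exists>t\<ge>0. v u t \<notin> ball p r))"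
  proof (intro eventually_ball_finite[OF finite_fixed] ballI eventually_conj)
    fix p assume p: "p \<in> fixed_points v"
    have "open (g -` {g p - \<eta><..<g p + \<eta>})"
      by (intro open_vimage continuous_on_lyapunov) (auto intro: continuous_intros)
    then obtain d where d: "d > 0" "ball p d \<subseteq> g -` {g p - \<eta><..<g p + \<eta>}"
      using \<eta>(1) by (auto elim!: openE)
    show "\<forall>\<^sub>F \<epsilon> in at_right 0. \<forall>u\<in>ball p \<epsilon>. \<bar>g u - g p\<bar> < \<eta>"
    proof (rule eventually_at_rightI[OF _ d(1)], intro ballI)
      fix e u assume "e \<in> {0<..<d}" "u \<in> ball p e"
      then have "u \<in> ball p d" by simp
      then have "u \<in> g -` {g p - \<eta><..<g p + \<eta>}"
        using d(2) by (rule subsetD[rotated])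
      then have "g p - \<eta> < g u" "g u < g p + \<eta>"
        by simp_all
      then show "\<bar>g u - g p\<bar> < \<eta>" by linarith
    qed
    obtain d where d: "d > 0"
      "\<And>u \<tau>. u \<in> ball p d \<Longrightarrow> \<tau> \<ge> 0 \<Longrightarrow> v u \<tau> \<notin> ball p (r / 2) \<Longrightarrow> \<exists>t\<ge>0. v u t \<notin> ball p r"
      using half_ball_exit_is_final[OF p] by blast
    show "\<forall>\<^sub>F \<epsilon> in at_right 0. \<forall>u\<in>ball p \<epsilon>. \<forall>\<tau>\<ge>0.
        v u \<tau> \<notin> ball p (r / 2) \<longrightarrow> (\<exists>t\<ge>0. v u t \<notin> ball p r)"
    proof (rule eventually_at_rightI[OF _ d(1)], intro ballI allI impI)
      fix e u \<tau>
      assume "e \<in> {0<..<d}" "u \<in> ball p e" "0 \<le> \<tau>" "v u \<tau> \<notin> ball p (r / 2)"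
      then show "\<exists>t\<ge>0. v u t \<notin> ball p r"
        by (intro d(2)[of u \<tau>]) simp_all
    qed
  qed
  moreover have "\<forall>\<^sub>F \<epsilon> in at_right 0. \<epsilon> < r / 4"
    using r_pos by (intro eventually_at_rightI[of 0 "r / 4"]) auto
  moreover have "\<forall>\<^sub>F \<epsilon> in at_right (0::real). 0 < \<epsilon>"
    by (rule eventually_at_right_less)
  ultimately have "\<forall>\<^sub>F \<epsilon> in at_right 0. 0 < \<epsilon> \<and> \<epsilon> \<le> r / 4 \<and> (\<forall>p\<in>fixed_points v.
      (\<forall>u\<in>ball p \<epsilon>. \<bar>g u - g p\<bar> < \<eta>) \<and>
      (\<forall>u\<in>ball p \<epsilon>. \<forall>\<tau>\<ge>0. v u \<tau> \<notin> ball p (r / 2) \<longrightarrow> (\<exists>t\<ge>0. v u t \<notin> ball p r)))"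
    by eventually_elim auto
  from eventually_happens'[OF trivial_limit_at_right_real this] obtain \<epsilon> where \<epsilon>: "0 < \<epsilon>" "\<epsilon> \<le> r / 4"
      "\<And>p. p \<in> fixed_points v \<Longrightarrow> (\<forall>u\<in>ball p \<epsilon>. \<bar>g u - g p\<bar> < \<eta>) \<and>
      (\<forall>u\<in>ball p \<epsilon>. \<forall>\<tau>\<ge>0. v u \<tau> \<notin> ball p (r / 2) \<longrightarrow> (\<exists>t\<ge>0. v u t \<notin> ball p r))"
    by blast
  have "linked_flow v g r D \<omega> \<eta> \<epsilon>"
    using D \<omega> \<eta> \<epsilon> by unfold_locales blast+
  with that show thesis by blast
qed


section \<open>Oscillation over small balls\<close>

lemma osc_bound:
  fixes g :: "'a \<Rightarrow> real"
  assumes "\<And>x. \<bar>g x\<bar> \<le> G" "y \<in> Y" "z \<in> Y"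
  shows "\<bar>g y - g z\<bar> \<le> osc g Y" "osc g Y \<le> 2 * G"
proof -
  have bdd: "bdd_above (g ` Y)" "bdd_below (g ` Y)"
    using assms(1) by (auto simp: abs_le_iff intro!: bdd_aboveI2[of _ _ G] bdd_belowI2[of _ "- G"])
      (metis minus_le_iff)
  have "g a \<le> (SUP y\<in>Y. g y)" "(INF y\<in>Y. g y) \<le> g a" if "a \<in> Y" for a
    using that bdd by (auto intro: cSUP_upper cINF_lower)
  from this[OF assms(2)] this[OF assms(3)] show "\<bar>g y - g z\<bar> \<le> osc g Y"
    unfolding osc_def by linarith
  have "(SUP y\<in>Y. g y) \<le> G"
    using assms by (intro cSUP_least) (auto simp: abs_le_iff)
  moreover have "- G \<le> (INF y\<in>Y. g y)"
    using assms by (intro cINF_greatest) (auto simp: abs_le_iff minus_le_iff)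
  ultimately show "osc g Y \<le> 2 * G"
    unfolding osc_def by linarith
qed

lemma (in lyapunov_flow) uniform_osc:
  assumes "s > 0"
  shows "y \<in> ball c s \<Longrightarrow> z \<in> ball c s \<Longrightarrow> \<bar>g y - g z\<bar> \<le> (SUP x. osc g (ball x s))"
    "0 \<le> (SUP x. osc g (ball x s))"
proof -
  obtain G where G: "\<And>x. \<bar>g x\<bar> \<le> G"
    using lyapunov_bounded by blast
  have "bdd_above (range (\<lambda>x. osc g (ball x s)))"
  proof (rule bdd_aboveI2)
    fix x
    show "osc g (ball x s) \<le> 2 * G"
      using osc_bound(2)[where g = g and y = x and z = x, OF G] assms by simp
  qed
  then have upper: "osc g (ball c s) \<le> (SUP x. osc g (ball x s))" for c
    by (rule cSUP_upper[OF UNIV_I])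
  show diff: "\<bar>g y - g z\<bar> \<le> (SUP x. osc g (ball x s))" if "y \<in> ball c s" "z \<in> ball c s" for y z c
    using osc_bound(1)[where g = g, OF G that] upper[of c] by linarith
  show "0 \<le> (SUP x. osc g (ball x s))"
    using diff[of undefined undefined undefined] assms by simp
qed


section \<open>Bounded integrals\<close>

locale lyapunov_cocycle = finite_lyapunov_flow v g r + flow_cocycle v \<alpha> r A
  for v :: "'a::metric_space \<Rightarrow> real \<Rightarrow> 'a" and g :: "'a \<Rightarrow> real"
    and r :: real and \<alpha> :: "'a \<times> 'a \<Rightarrow> real" and A :: real
begin

text \<open>
  Induction on the number \<open>n\<close> of portions \<open>2 D\<close> that \<open>g\<close> can still lose. Within bounded time the
  trajectory visits a ball of radius \<open>r/4\<close> around a fixed point. In the \<open>r\<close>-ball around that point the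
  integral is at most \<open>A\<close>, however long the trajectory stays, and leaving the \<open>r\<close>-ball uses up one portion.
\<close>

lemma trajectory_integral_bounded:
  assumes "D > 0" and D: "ereal D \<le> delta0 v g r"
  obtains M where "M \<ge> 0"
    "\<And>x a b. 0 \<le> a \<Longrightarrow> a \<le> b \<Longrightarrow> \<bar>trajectory_integral x b - trajectory_integral x a\<bar> \<le> M"
proof -
  obtain T where T: "T > 0" "\<And>x. \<exists>\<tau>\<in>{0..T}. \<exists>p\<in>fixed_points v. v x \<tau> \<in> ball p (r / 4)"
    using visits_fixed_points[of "r / 4"] r_pos by auto
  obtain K where K: "K \<ge> 0" "\<And>x a b. 0 \<le> a \<Longrightarrow> a \<le> b \<Longrightarrow> b \<le> a + T \<Longrightarrow>
       \<bar>trajectory_integral x b - trajectory_integral x a\<bar> \<le> K"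
    using trajectory_integral_bounded_time[of T] by blast
  have budget: "\<bar>trajectory_integral x b - trajectory_integral x a\<bar> \<le> real n * (K + A)"
    if "0 \<le> a" "a \<le> b" "g (v x a) - g (v x b) < real n * (2 * D)" for x a b n
    using that
  proof (induction n arbitrary: a)
    case 0
    then show ?case
      using lyapunov_mono[of a b x] by simp
  next
    case (Suc n)
    have expand: "real (Suc n) * (K + A) = real n * (K + A) + K + A"
      by (simp add: algebra_simps)
    have rest: "0 \<le> real n * (K + A)"
      using K(1) bound_nonneg by simp
    obtain \<tau>' p where \<tau>': "0 \<le> \<tau>'" "\<tau>' \<le> T" "p \<in> fixed_points v" "v (v x a) \<tau>' \<in> ball p (r / 4)"
      using T(2)[of "v x a"] by auto
    define \<tau> where "\<tau> = a + \<tau>'"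
    have \<tau>: "a \<le> \<tau>" "\<tau> \<le> a + T" "v x \<tau> \<in> ball p (r / 4)"
      using \<tau>' by (auto simp: \<tau>_def)
    show ?case
    proof (cases "b \<le> \<tau>")
      case True
      then have "\<bar>trajectory_integral x b - trajectory_integral x a\<bar> \<le> K"
        using Suc.prems \<tau> by (intro K(2)) auto
      then show ?thesis
        using rest bound_nonneg unfolding expand by linarith
    next
      case False
      have before: "\<bar>trajectory_integral x \<tau> - trajectory_integral x a\<bar> \<le> K"
        using Suc.prems \<tau> by (intro K(2)) auto
      show ?thesis
      proof (cases "v x b \<in> ball p r \<and> v x ` {\<tau>..b} \<subseteq> ball p r")
        case True
        then have "v x ` {\<tau>..b} \<subseteq> closure (ball p r)"
          using closure_subset[of "ball p r"] by blast
        then have "trajectory_integral x b - trajectory_integral x \<tau> = \<alpha> (v x \<tau>, v x b)"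
          using Suc.prems \<tau> False by (intro trajectory_integral_diff) auto
        then have "\<bar>trajectory_integral x b - trajectory_integral x \<tau>\<bar> \<le> A"
          using cocycle_bound by simp
        then show ?thesis
          using before rest unfolding expand by linarith
      next
        case leaves: False
        then obtain t where t: "\<tau> \<le> t" "t \<le> b" "v x t \<notin> ball p r"
          using False by (metis atLeastAtMost_iff image_subsetI linear order_refl)
        have "continuous_on {\<tau>..t} (v x)"
          by (intro continuous_intros)
        moreover have "v x \<tau> \<in> ball p r"
          using \<tau>(3) r_pos by simp
        ultimately obtain c where c: "\<tau> < c" "c \<le> t" "v x c \<in> frontier (ball p r)"
            "\<forall>t\<in>{\<tau>..<c}. v x t \<in> ball p r"
          using first_exit_time[of \<tau> t "v x" "ball p r"] t by blast
        have "v x s \<in> closure (ball p r)" if "s \<in> {\<tau>..c}" for s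
          using that c(3,4) closure_subset[of "ball p r"]
          by (cases "s = c") (auto simp: frontier_def)
        then have "v x ` {\<tau>..c} \<subseteq> closure (ball p r)" by blast
        then have "trajectory_integral x c - trajectory_integral x \<tau> = \<alpha> (v x \<tau>, v x c)"
          using Suc.prems \<tau> c(1) by (intro trajectory_integral_diff) auto
        then have inside: "\<bar>trajectory_integral x c - trajectory_integral x \<tau>\<bar> \<le> A"
          using cocycle_bound by simp
        have "v x c \<notin> ball p r"
          using frontier_ball_dist[OF c(3)] by simp
        then have "g (v x c) + 2 * D \<le> g (v x \<tau>)"
          using leaving_drop[OF r_pos delta0_lower(2)[OF D \<tau>'(3)] \<tau>(3), of "c - \<tau>"] c(1) by simp
        moreover have "g (v x \<tau>) \<le> g (v x a)"
          using \<tau>(1) by (rule lyapunov_mono)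
        moreover have "real (Suc n) * (2 * D) = real n * (2 * D) + 2 * D"
          by (simp add: algebra_simps)
        ultimately have "g (v x c) - g (v x b) < real n * (2 * D)"
          using Suc.prems(3) by linarith
        then have "\<bar>trajectory_integral x b - trajectory_integral x c\<bar> \<le> real n * (K + A)"
          using Suc.prems(1) \<tau>(1) c t by (intro Suc.IH) auto
        then show ?thesis
          using before inside unfolding expand by linarith
      qed
    qed
  qed
  obtain G where G: "\<And>x. \<bar>g x\<bar> \<le> G"
    using lyapunov_bounded by blast
  obtain N :: nat where N: "2 * G < real N * (2 * D)"
    using ex_less_of_nat_mult[of "2 * D" "2 * G"] \<open>D > 0\<close> by auto
  show thesis
  proof (rule that[of "real N * (K + A)"])
    show "0 \<le> real N * (K + A)"
      using K(1) bound_nonneg by simp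
    fix x a b assume "0 \<le> (a::real)" "a \<le> b"
    moreover have "g (v x a) - g (v x b) < real N * (2 * D)"
      using G[of "v x a"] G[of "v x b"] N by linarith
    ultimately show "\<bar>trajectory_integral x b - trajectory_integral x a\<bar> \<le> real N * (K + A)"
      by (rule budget)
  qed
qed

end

locale linked_cocycle = linked_flow v g r D \<omega> \<eta> \<epsilon> + lyapunov_cocycle v g r \<alpha> A
  for v :: "'a::metric_space \<Rightarrow> real \<Rightarrow> 'a" and g :: "'a \<Rightarrow> real"
    and r D \<omega> \<eta> \<epsilon> :: real and \<alpha> :: "'a \<times> 'a \<Rightarrow> real" and A :: real
begin

lemma link_stay_integral:
  assumes l: "link p (v x \<tau>) (t - \<tau>) z \<sigma> p" and \<tau>: "0 \<le> \<tau>"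
  shows "trajectory_integral x t - trajectory_integral x \<tau> + \<alpha> (v x t, z) + trajectory_integral z \<sigma>
    = \<alpha> (v x \<tau>, v z \<sigma>)"
proof -
  have times: "0 \<le> t - \<tau>" "0 \<le> \<sigma>"
    using l by (auto simp: link_def)
  have "v x ` {\<tau>..t} \<subseteq> v (v x \<tau>) ` {0..t - \<tau>}"
  proof
    fix y assume "y \<in> v x ` {\<tau>..t}"
    then obtain s where "s \<in> {\<tau>..t}" "y = v x s" by blast
    then show "y \<in> v (v x \<tau>) ` {0..t - \<tau>}"
      by (intro image_eqI[of _ _ "s - \<tau>"]) auto
  qed
  then have arc1: "v x ` {\<tau>..t} \<subseteq> closure (ball p r)"
    using link_stay(1)[OF l] closure_subset[of "ball p r"] by blast
  have arc2: "v z ` {0..\<sigma>} \<subseteq> closure (ball p r)"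
    using link_stay(2)[OF l] closure_subset[of "ball p r"] by blast
  have "trajectory_integral x t - trajectory_integral x \<tau> = \<alpha> (v x \<tau>, v x t)"
    using arc1 \<tau> times by (intro trajectory_integral_diff) auto
  moreover have "trajectory_integral z \<sigma> - trajectory_integral z 0 = \<alpha> (v z 0, v z \<sigma>)"
    using arc2 times by (intro trajectory_integral_diff) auto
  moreover have pts: "v x \<tau> \<in> closure (ball p r)" "v x t \<in> closure (ball p r)"
      "v z 0 \<in> closure (ball p r)" "v z \<sigma> \<in> closure (ball p r)"
    using times by (auto intro!: subsetD[OF arc1, OF imageI] subsetD[OF arc2, OF imageI] simp del: flow_zero)
  moreover have "\<alpha> (v x \<tau>, v x t) + \<alpha> (v x t, v z 0) = \<alpha> (v x \<tau>, v z 0)"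
      "\<alpha> (v x \<tau>, v z 0) + \<alpha> (v z 0, v z \<sigma>) = \<alpha> (v x \<tau>, v z \<sigma>)"
    using pts cocycle_add by blast+
  ultimately show ?thesis by simp
qed

text \<open>
  The potential \<open>\<Phi> i\<close> is the integral from the beginning of the chain to the visit on segment \<open>i\<close>.
  Cutting at the visits instead of at the jumps makes both ends of a constant run points near one
  fixed point, so that the run contributes a single value of \<open>\<alpha>\<close>.
\<close>

lemma linked_chain_bound:
  fixes x :: "nat \<Rightarrow> 'a" and t \<tau> :: "nat \<Rightarrow> real" and p :: "nat \<Rightarrow> 'a"
  assumes M: "0 \<le> M" "\<And>x a b. 0 \<le> a \<Longrightarrow> a \<le> b \<Longrightarrow> \<bar>trajectory_integral x b - trajectory_integral x a\<bar> \<le> M"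
    and visit: "\<And>i. i \<le> m \<Longrightarrow> 0 \<le> \<tau> i \<and> \<tau> i \<le> t i \<and> p i \<in> fixed_points v \<and> v (x i) (\<tau> i) \<in> ball (p i) \<epsilon>"
    and link: "\<And>i. i < m \<Longrightarrow>
      link (p i) (v (x i) (\<tau> i)) (t i - \<tau> i) (x (Suc i)) (\<tau> (Suc i)) (p (Suc i))"
  shows "\<bar>chain_integral v \<alpha> r (Suc m) x t\<bar>
    \<le> 2 * real (card (fixed_points v)) * (A + (2 * M + A)) + 2 * M + A"
proof -
  define u where "u i = v (x i) (\<tau> i)" for i
  define \<Phi> where "\<Phi> i = (\<Sum>j<i. trajectory_integral (x j) (t j) + \<alpha> (v (x j) (t j), x (Suc j)))
      + trajectory_integral (x i) (\<tau> i)" for i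
  have \<Phi>_step: "\<Phi> (Suc i) - \<Phi> i = trajectory_integral (x i) (t i) - trajectory_integral (x i) (\<tau> i)
      + \<alpha> (v (x i) (t i), x (Suc i)) + trajectory_integral (x (Suc i)) (\<tau> (Suc i))" for i
    by (simp add: \<Phi>_def)
  have start: "\<bar>trajectory_integral (x i) (\<tau> i)\<bar> \<le> M" if "i \<le> m" for i
    using M(2)[of 0 "\<tau> i" "x i"] visit[OF that] by simp
  have finish: "\<bar>trajectory_integral (x i) (t i) - trajectory_integral (x i) (\<tau> i)\<bar> \<le> M" if "i \<le> m" for i
    using M(2)[of "\<tau> i" "t i" "x i"] visit[OF that] by simp
  have "\<bar>\<Phi> m - \<Phi> 0\<bar> \<le> 2 * real (card (fixed_points v)) * (A + (2 * M + A))"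
  proof (rule potential_bound_by_node_count[where c = p and h = g])
    show "finite (fixed_points v)" "inj_on g (fixed_points v)" "0 \<le> A"
      by (rule finite_fixed inj_on_fixed_points bound_nonneg)+
    show "0 \<le> 2 * M + A"
      using M(1) bound_nonneg by simp
    show "p i \<in> fixed_points v" if "i \<le> m" for i
      using visit[OF that] by blast
    show "\<bar>\<Phi> (Suc i) - \<Phi> i\<bar> \<le> 2 * M + A" if "i < m" for i
      using finish[of i] start[of "Suc i"] cocycle_bound[of "(v (x i) (t i), x (Suc i))"] that
      unfolding \<Phi>_step by linarith
  next
    fix i j assume ij: "i \<le> j" "j \<le> m" and const: "\<forall>l\<in>{i..j}. p l = p i"
    have near_p: "u l \<in> closure (ball (p i) r)" if "i \<le> l" "l \<le> j" for l
    proof -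
      have "p l = p i"
        using const that by (meson atLeastAtMost_iff)
      moreover have "u l \<in> ball (p l) \<epsilon>"
        using visit[of l] that ij by (simp add: u_def)
      ultimately have "u l \<in> ball (p i) r"
        using \<epsilon> by simp
      then show ?thesis
        using closure_subset by blast
    qed
    have "\<Phi> l - \<Phi> i = \<alpha> (u i, u l)" if "i \<le> l" "l \<le> j" for l
      using that
    proof (induction l rule: dec_induct)
      case (step l)
      have "p l = p i" "p (Suc l) = p i"
        using const step.hyps step.prems by (meson Suc_leD atLeastAtMost_iff le_SucI)+
      then have "link (p i) (v (x l) (\<tau> l)) (t l - \<tau> l) (x (Suc l)) (\<tau> (Suc l)) (p i)"
        using link[of l] step ij by simp
      then have "\<Phi> (Suc l) - \<Phi> l = \<alpha> (u l, u (Suc l))"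
        using link_stay_integral visit[of l] step ij unfolding \<Phi>_step u_def by simp
      moreover have "\<alpha> (u i, u l) + \<alpha> (u l, u (Suc l)) = \<alpha> (u i, u (Suc l))"
        using near_p step ij by (intro cocycle_add[of _ "p i"]) auto
      ultimately show ?case
        using step by simp
    qed simp
    from this[of j] ij show "\<bar>\<Phi> j - \<Phi> i\<bar> \<le> A"
      using cocycle_bound by simp
  next
    fix i j assume ij: "i < j" "j < m" and up: "g (p i) < g (p (Suc i))"
      and const: "\<forall>l\<in>{Suc i..j}. p l = p (Suc i)" and ne: "p (Suc j) \<noteq> p (Suc i)"
    have pj: "p j = p (Suc i)"
      using const ij by (metis Suc_leI atLeastAtMost_iff order_refl)
    show "g (p (Suc j)) < g (p i)"
    proof (rule link_rebound[OF link[OF ij(2)]])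
      show "p (Suc j) \<noteq> p j" "g (p i) < g (p j)"
        using ne up by (simp_all add: pj)
      show "p i \<in> fixed_points v"
        using visit[of i] ij by simp
      show "g (p j) < g (p i) + \<omega> + 2 * \<eta>"
        using link_increase[OF link[of i]] ij by (simp add: pj)
    qed
  qed
  moreover have "\<bar>\<Phi> 0\<bar> \<le> M"
    using start[of 0] by (simp add: \<Phi>_def)
  moreover have "chain_integral v \<alpha> r (Suc m) x t = \<Phi> m
      + (trajectory_integral (x m) (t m) - trajectory_integral (x m) (\<tau> m))
      + \<alpha> (v (x m) (t m), x (Suc m))"
    by (simp add: chain_integral_def \<Phi>_def)
  ultimately show ?thesis
    using finish[of m] cocycle_bound[of "(v (x m) (t m), x (Suc m))"] by linarith
qed

end


theorem theorem3p2:
  fixes v :: "'a::metric_space \<Rightarrow> real \<Rightarrow> 'a"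
    and g :: "'a \<Rightarrow> real"
    and \<alpha> :: "'a \<times> 'a \<Rightarrow> real"
    and r :: real
  assumes "compact (UNIV :: 'a set)"
    and "gradient_like v"
    and "finite (fixed_points v)"
    and "lyapunov_function v g"
    and "continuous_cocycle \<alpha>"
    and "associated_covering \<alpha> r"
    and "disjoint_family_on (\<lambda>p. g ` ball p r) (fixed_points v)"
  shows "\<exists>M>0. \<forall>s\<^sub>0. 0 < s\<^sub>0 \<and> s\<^sub>0 < r / 4 \<and>
           ereal (3 * (SUP x. osc g (ball x s\<^sub>0))) < delta0 v g r \<longrightarrow>
           (\<exists>T>0. \<forall>s<s\<^sub>0. \<forall>\<U>. ball_covering \<U> s \<longrightarrow>
             (\<forall>k x t. chain v \<U> T k x t \<longrightarrow> \<bar>chain_integral v \<alpha> r k x t\<bar> \<le> M))"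
proof -
  have "bounded (range \<alpha>)"
    using assms(5) by (simp add: continuous_cocycle_def)
  then obtain A where A: "\<And>z. \<bar>\<alpha> z\<bar> \<le> A"
    by (auto simp: bounded_iff)
  interpret lyapunov_cocycle v g r \<alpha> A
  proof unfold_locales
    show "is_flow v"
      using assms(2) by (simp add: gradient_like_def)
    show "r > 0"
      using assms(6) by (simp add: associated_covering_def)
  qed (use assms A in auto)
  show ?thesis
  proof (cases "0 < delta0 v g r")
    case False
    \<comment> \<open>Oscillations are nonnegative, so no \<open>s\<^sub>0\<close> is admissible and any bound will do.\<close>
    have "\<not> (0 < s \<and> ereal (3 * (SUP x. osc g (ball x s))) < delta0 v g r)" for s
      using uniform_osc(2)[of s] False by (metis ereal_less_eq(5) le_less_trans mult_nonneg_nonneg zero_le_numeral)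
    then show ?thesis
      by (intro exI[of _ 1]) auto
  next
    case True
    \<comment> \<open>The bound is fixed before \<open>s\<^sub>0\<close> is given, so it may not use the \<open>D\<close> chosen below, which depends
      on \<open>s\<^sub>0\<close>. Any positive lower bound of \<open>\<delta>\<^sub>0(r)\<close> serves to bound the integrals along trajectories.\<close>
    then obtain D0 where D0: "D0 > 0" "ereal D0 \<le> delta0 v g r"
      using ereal_dense2[OF True] by (auto intro: less_imp_le)
    obtain M where M: "M \<ge> 0"
        "\<And>x a b. 0 \<le> a \<Longrightarrow> a \<le> b \<Longrightarrow> \<bar>trajectory_integral x b - trajectory_integral x a\<bar> \<le> M"
      using trajectory_integral_bounded[OF D0] by blast
    define B where "B = 2 * real (card (fixed_points v)) * (A + (2 * M + A)) + 2 * M + A"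
    have "B \<ge> 0"
      using M(1) bound_nonneg by (simp add: B_def)
    show ?thesis
    proof (rule exI[of _ "B + 1"], intro conjI allI impI)
      show "0 < B + 1"
        using \<open>B \<ge> 0\<close> by simp
    next
      fix s\<^sub>0
      assume s\<^sub>0: "0 < s\<^sub>0 \<and> s\<^sub>0 < r / 4 \<and> ereal (3 * (SUP x. osc g (ball x s\<^sub>0))) < delta0 v g r"
      define \<omega> where "\<omega> = (SUP x. osc g (ball x s\<^sub>0))"
      have osc_le: "0 \<le> \<omega>" "\<And>c y z. y \<in> ball c s\<^sub>0 \<Longrightarrow> z \<in> ball c s\<^sub>0 \<Longrightarrow> \<bar>g y - g z\<bar> \<le> \<omega>"
        using uniform_osc[of s\<^sub>0] s\<^sub>0 unfolding \<omega>_def by blast+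
      obtain D where D: "3 * \<omega> < D" "ereal D \<le> delta0 v g r"
        using ereal_dense2[of "ereal (3 * \<omega>)" "delta0 v g r"] s\<^sub>0 by (auto simp: \<omega>_def intro: less_imp_le)
      obtain \<eta> \<epsilon> where "linked_flow v g r D \<omega> \<eta> \<epsilon>"
        using linked_flow_exists[OF D(2) osc_le(1) D(1)] by blast
      then interpret linked_cocycle v g r D \<omega> \<eta> \<epsilon> \<alpha> A
        by (intro linked_cocycle.intro lyapunov_cocycle_axioms)
      obtain T where T: "T > 0" "\<And>x. \<exists>\<tau>\<in>{0..T}. \<exists>p\<in>fixed_points v. v x \<tau> \<in> ball p \<epsilon>"
        using visits_fixed_points[OF \<epsilon>(1)] by blast
      then have "\<forall>x. \<exists>\<tau> p. 0 \<le> \<tau> \<and> \<tau> \<le> T \<and> p \<in> fixed_points v \<and> v x \<tau> \<in> ball p \<epsilon>"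
        by (meson atLeastAtMost_iff)
      then obtain \<tau> p where visit: "\<And>x. 0 \<le> \<tau> x \<and> \<tau> x \<le> T \<and> p x \<in> fixed_points v \<and> v x (\<tau> x) \<in> ball (p x) \<epsilon>"
        by metis
      show "\<exists>T>0. \<forall>s<s\<^sub>0. \<forall>\<U>. ball_covering \<U> s \<longrightarrow>
          (\<forall>k x t. chain v \<U> T k x t \<longrightarrow> \<bar>chain_integral v \<alpha> r k x t\<bar> \<le> B + 1)"
      proof (rule exI[of _ T], intro conjI allI impI)
        show "0 < T"
          by (rule T(1))
      next
        fix s \<U> k x t
        assume s: "s < s\<^sub>0" and cov: "ball_covering \<U> s" and ch: "chain v \<U> T k x t"
        have "k \<ge> 1" and times: "\<And>i. i < k \<Longrightarrow> T \<le> t i"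
          using ch by (auto simp: chain_def)
        then obtain m where k: "k = Suc m"
          by (cases k) auto
        have jump: "dist (v (x i) (t i)) (x (Suc i)) < r / 2 \<and> \<bar>g (v (x i) (t i)) - g (x (Suc i))\<bar> \<le> \<omega>"
          if ik: "i < k" for i
        proof -
          obtain U where U: "U \<in> \<U>" "v (x i) (t i) \<in> U" "x (Suc i) \<in> U"
            using ch ik by (auto simp: chain_def)
          moreover obtain c where "U = ball c s"
            using cov U(1) unfolding ball_covering_def by blast
          ultimately have c: "v (x i) (t i) \<in> ball c s" "x (Suc i) \<in> ball c s"
            by simp_all
          then have "dist (v (x i) (t i)) (x (Suc i)) < r / 2"
            using dist_triangle3[of "v (x i) (t i)" "x (Suc i)" c] s s\<^sub>0 by simp
          moreover have "\<bar>g (v (x i) (t i)) - g (x (Suc i))\<bar> \<le> \<omega>"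
            using c s by (intro osc_le(2)[of _ c]) auto
          ultimately show ?thesis by blast
        qed
        have "\<bar>chain_integral v \<alpha> r (Suc m) x t\<bar> \<le> B"
          unfolding B_def
        proof (rule linked_chain_bound[where \<tau> = "\<lambda>i. \<tau> (x i)" and p = "\<lambda>i. p (x i)", OF M])
          fix i assume "i \<le> m"
          then show "0 \<le> \<tau> (x i) \<and> \<tau> (x i) \<le> t i \<and> p (x i) \<in> fixed_points v \<and>
              v (x i) (\<tau> (x i)) \<in> ball (p (x i)) \<epsilon>"
            using visit[of "x i"] times[of i] k by auto
        next
          fix i assume "i < m"
          then show "link (p (x i)) (v (x i) (\<tau> (x i))) (t i - \<tau> (x i)) (x (Suc i))
              (\<tau> (x (Suc i))) (p (x (Suc i)))"
            using visit[of "x i"] visit[of "x (Suc i)"] times[of i] jump[of i] k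
            by (auto simp: link_def)
        qed
        then show "\<bar>chain_integral v \<alpha> r k x t\<bar> \<le> B + 1"
          by (simp add: k)
      qed
    qed
  qed
qed

end
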